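(* For every integer $k\ge 4$, $\tilde{r}(P_3,P_3,C_{4k+3}) \le 6k+5$.
   Context: $P_m$ denotes the path and $C_m$ the cycle on $m$ vertices. The three-color online Ramsey game for graphs $G_1,G_2,G_3$ is played by Builder and Painter on an infinite vertex set with initially no edges. In each round Builder draws an edge between two currently nonadjacent vertices, and Painter immediately colors it red, blue or green. Builder wins once the colored graph contains a red copy of $G_1$, a blue copy of $G_2$, or a green copy of $G_3$. The online Ramsey number $\tilde{r}(G_1,G_2,G_3)$ is the minimum number of rounds within which Builder can guarantee a win against every strategy of Painter. *)

theory Defs
  imports "HOL-Library.Extended_Nat"
begin

type_synonym 'a graph = "'a set \<times> 'a set set"

definition path_graph :: "nat \<Rightarrow> nat graph" where
  "path_graph m = ({0..<m}, {{i, i + 1} | i. i + 1 < m})"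

text \<open>The cycle on \<open>m\<close> vertices is a simple graph only for \<open>m \<ge> 3\<close>.\<close>

definition cycle_graph :: "nat \<Rightarrow> nat graph" where
  "cycle_graph m = ({0..<m}, {{i, (i + 1) mod m} | i. i < m})"

text \<open>Copies are subgraphs, not necessarily induced.\<close>

definition contains_copy :: "'v set set \<Rightarrow> 'a graph \<Rightarrow> bool" where
  "contains_copy E G \<longleftrightarrow>
     (\<exists>f. inj_on f (fst G) \<and> (\<forall>e \<in> snd G. f ` e \<in> E))"

datatype colour = Red | Blue | Green

text \<open>The board has vertex set \<open>UNIV :: nat set\<close>. A history lists the coloured edges
  in the order in which they were drawn.\<close>

type_synonym history = "(nat set \<times> colour) list"

type_synonym builder = "history \<Rightarrow> nat set"

type_synonym painter = "history \<Rightarrow> nat set \<Rightarrow> colour"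

definition colour_class :: "history \<Rightarrow> colour \<Rightarrow> nat set set" where
  "colour_class h c = {e. (e, c) \<in> set h}"

definition legal_move :: "history \<Rightarrow> nat set \<Rightarrow> bool" where
  "legal_move h e \<longleftrightarrow> (\<exists>u v. u \<noteq> v \<and> e = {u, v}) \<and> e \<notin> fst ` set h"

text \<open>Only finitely many edges occur in a history, so a legal move always exists and
  demanding legality at every history excludes no way of playing.\<close>

definition legal_builder :: "builder \<Rightarrow> bool" where
  "legal_builder b \<longleftrightarrow> (\<forall>h. legal_move h (b h))"

primrec play :: "builder \<Rightarrow> painter \<Rightarrow> nat \<Rightarrow> history" where
  "play b p 0 = []"
| "play b p (Suc n) =
     (let h = play b p n; e = b h in h @ [(e, p h e)])"

definition builder_won :: "'a graph \<Rightarrow> 'b graph \<Rightarrow> 'c graph \<Rightarrow> history \<Rightarrow> bool" where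
  "builder_won G1 G2 G3 h \<longleftrightarrow>
     contains_copy (colour_class h Red) G1 \<or>
     contains_copy (colour_class h Blue) G2 \<or>
     contains_copy (colour_class h Green) G3"

definition builder_wins_within ::
  "'a graph \<Rightarrow> 'b graph \<Rightarrow> 'c graph \<Rightarrow> nat \<Rightarrow> bool" where
  "builder_wins_within G1 G2 G3 n \<longleftrightarrow>
     (\<exists>b. legal_builder b \<and> (\<forall>p. \<exists>m\<le>n. builder_won G1 G2 G3 (play b p m)))"

text \<open>The value is \<open>\<infinity>\<close> if Builder cannot guarantee a win within any fixed number of
  rounds; otherwise the infimum is attained.\<close>

definition online_ramsey :: "'a graph \<Rightarrow> 'b graph \<Rightarrow> 'c graph \<Rightarrow> enat" where
  "online_ramsey G1 G2 G3 = Inf {enat n | n. builder_wins_within G1 G2 G3 n}"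

end

theory Submission
  imports Defs
begin

text \<open>
  Red and blue are matchings, so an edge is forced to be green as soon as each of the two colours
  occurs at one of its ends. Call a vertex full, half or free if both, one or none of red and blue
  occur at it. Of the \<open>6k + 5\<close> rounds, \<open>4k + 3\<close> draw the cycle, which leaves \<open>2k + 2\<close> other edges;
  one such edge pays for two vertices of the cycle, since a full vertex forces both of
  its edges.

  Builder maintains a path \<open>P\<close> of green or forced edges and measures the number \<open>D\<close> of missing
  vertices against the remaining rounds; the admissible ratio depends only on the types
  of the two ends of \<open>P\<close>, on whether a half vertex \<open>c\<close> off the path is available, and on whether
  there is a ``bank'' \<open>K\<close>, a second path running from a full to a free end. An edge from an end of \<open>P\<close>
  or from \<open>c\<close> to a fresh vertex never spoils the balance, whatever its colour. Two edges from
  \<open>c\<close> to fresh vertices either make \<open>c\<close> full, so that the bank grows by two vertices, or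
  absorb \<open>c\<close> into a green path on three vertices.

  The opening position has no slack in this balance. As long as Painter gives none away, all red and
  blue edges form one alternating path; then the colours at its ends are determined by the parity
  of its length, and for cycle length \<open>4k + 3\<close> they are the ones that Builder needs at the end. If
  Painter avoids full vertices altogether, every red or blue edge yields three vertices of \<open>P\<close>, and
  \<open>k \<ge> 4\<close> leaves enough rounds to close the cycle by brute force.
\<close>

text \<open>The constants come from one count. If \<open>D\<close> vertices are missing and the part
  built consists of \<open>p\<close> disjoint pieces, then \<open>D + p + cost\<close> edges of the
  cycle are still to be drawn, so with \<open>r\<close> spare rounds
  \<open>n = D + p + r + cost\<close>. Substituting this, the positions with a bank read
  \<open>D \<le> 2r + 1\<close> for \<open>full_full_plus\<close>, \<open>2r\<close> for
  \<open>half_full_plus\<close>, \<open>2r - 1\<close> for \<open>half_full\<close> and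
  \<open>2r - 2\<close> for \<open>free_full\<close>; without a bank the bounds are one smaller. A
  green answer lowers \<open>D\<close>, a coloured one lowers \<open>r\<close>, and the bounds are
  spaced so that either answer lands on an admissible position. The obstacle is the opening: after a
  green first edge \<open>D = 4k + 1 = 2r - 3\<close>, which is already the bound for a free and a
  full end without a bank, although no end is full yet. Hence the separate positions without a full
  end, where \<open>D\<close> is bounded by \<open>3r - 2k\<close> minus a constant, and the
  treatment of the cases of equality, in which pieces stay detached and colours are followed by
  parity.\<close>

definition drawn :: "history \<Rightarrow> nat \<Rightarrow> nat \<Rightarrow> bool" where
  "drawn h u v \<longleftrightarrow> {u, v} \<in> fst ` set h"

definition green :: "history \<Rightarrow> nat \<Rightarrow> nat \<Rightarrow> bool" where
  "green h u v \<longleftrightarrow> ({u, v}, Green) \<in> set h"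

text \<open>The inequality discards singletons: a history is an arbitrary list, and a degenerate
  \<open>{v, v}\<close> must not count as an edge at \<open>v\<close>.\<close>

definition hit :: "history \<Rightarrow> colour \<Rightarrow> nat \<Rightarrow> bool" where
  "hit h c v \<longleftrightarrow> (\<exists>x. x \<noteq> v \<and> ({v, x}, c) \<in> set h)"

abbreviation full :: "history \<Rightarrow> nat \<Rightarrow> bool" where
  "full h v \<equiv> hit h Red v \<and> hit h Blue v"

definition draw :: "history \<Rightarrow> nat \<Rightarrow> nat \<Rightarrow> colour \<Rightarrow> history" where
  "draw h a b c = h @ [({a, b}, c)]"

text \<open>Forced edges are kept undrawn until the cycle is closed; paths may contain them, and
  \<open>cost\<close> counts them.\<close>

definition green_or_forced :: "history \<Rightarrow> nat \<Rightarrow> nat \<Rightarrow> bool" where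
  "green_or_forced h u v \<longleftrightarrow> green h u v \<or>
     u \<noteq> v \<and> \<not> drawn h u v \<and> (\<forall>c. c \<noteq> Green \<longrightarrow> hit h c u \<or> hit h c v)"

fun cost :: "history \<Rightarrow> nat list \<Rightarrow> nat" where
  "cost h (x # y # zs) = (if green h x y then 0 else 1) + cost h (y # zs)"
| "cost h _ = 0"

text \<open>Free ends are only needed to guarantee that an edge has not been drawn yet, hence this
  bound on the neighbours instead of a statement about colours.\<close>

definition nbrs_in :: "history \<Rightarrow> nat \<Rightarrow> nat set \<Rightarrow> bool" where
  "nbrs_in h v S \<longleftrightarrow> (\<forall>x. drawn h v x \<longrightarrow> x \<in> S)"

definition gpath :: "history \<Rightarrow> nat list \<Rightarrow> bool" where
  "gpath h xs \<longleftrightarrow> distinct xs \<and> successively (green_or_forced h) xs"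

fun other :: "colour \<Rightarrow> colour" where
  "other Red = Blue" | "other Blue = Red" | "other Green = Green"

text \<open>Backward induction over positions replaces strategies; \<open>n\<close> counts the
  rounds left. A position already won counts for every \<open>n\<close>, which gives
  monotonicity.\<close>

primrec win :: "nat \<Rightarrow> nat \<Rightarrow> history \<Rightarrow> bool" where
  "win l 0 h \<longleftrightarrow> builder_won (path_graph 3) (path_graph 3) (cycle_graph l) h"
| "win l (Suc n) h \<longleftrightarrow> builder_won (path_graph 3) (path_graph 3) (cycle_graph l) h \<or>
     (\<exists>e. legal_move h e \<and> (\<forall>c. win l n (h @ [(e, c)])))"

section \<open>The game as a recursion on positions\<close>

lemma win_Suc: "win l n h \<Longrightarrow> win l (Suc n) h"
proof (induction n arbitrary: h)
  case (Suc n)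
  then show ?case
    unfolding win.simps(2)[of l "Suc n"] using win.simps(2)[of l n h] by blast
qed simp

lemma win_mono:
  assumes "win l n h" "n \<le> m"
  shows "win l m h"
  using assms(2,1) by (induction rule: dec_induct) (blast intro: win_Suc)+

lemma drawn_sym: "drawn h u v = drawn h v u"
  by (simp add: drawn_def insert_commute)

lemma green_sym: "green h u v = green h v u"
  by (simp add: green_def insert_commute)

lemma green_or_forced_sym: "green_or_forced h u v = green_or_forced h v u"
  by (auto simp: green_or_forced_def drawn_sym green_sym)

lemma ex_fresh:
  assumes "finite S"
  obtains x where "x \<notin> S" "\<And>y. \<not> drawn h x y" "\<And>y. \<not> drawn h y x"
proof -
  \<comment> \<open>An arbitrary history may contain infinite sets. They are dropped here, since
    \<open>drawn\<close> only concerns sets with at most two elements.\<close>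
  define B where "B = (\<Union>e \<in> fst ` set h. if finite e then e else {})"
  have "finite (S \<union> B)"
    using assms by (auto simp: B_def)
  then obtain x where x: "x \<notin> S \<union> B"
    using ex_new_if_finite infinite_UNIV_nat by blast
  have "\<not> drawn h x y" for y
  proof
    assume "drawn h x y"
    then have "{x, y} \<in> fst ` set h"
      by (simp add: drawn_def)
    then have "x \<in> B"
      unfolding B_def by (rule UN_I) auto
    then show False
      using x by auto
  qed
  then show thesis
    using that x drawn_sym by blast
qed

lemma ex_legal_move: "\<exists>e. legal_move h e"
proof -
  obtain x where "x \<notin> {0}" "\<And>y. \<not> drawn h x y" "\<And>y. \<not> drawn h y x"
    by (rule ex_fresh[of "{0}" h]) simp_all
  then have "legal_move h {x, 0}"
    by (auto simp: legal_move_def drawn_def)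
  then show ?thesis ..
qed

text \<open>Builder picks a move that keeps \<open>win\<close> for the remaining rounds, which the
  length of the history determines. Legality is required at all histories, so off the winning lines
  the strategy falls back on some legal move.\<close>

lemma builder_wins_within_if_win:
  assumes "win l n []"
  shows "builder_wins_within (path_graph 3) (path_graph 3) (cycle_graph l) n"
proof -
  define good where
    "good h e \<longleftrightarrow> legal_move h e \<and> (\<forall>c. win l (n - Suc (length h)) (h @ [(e, c)]))" for h e
  define b where
    "b h = (if \<exists>e. good h e then SOME e. good h e else SOME e. legal_move h e)" for h
  have legal: "legal_builder b"
    unfolding legal_builder_def
  proof
    fix h
    show "legal_move h (b h)"
    proof (cases "\<exists>e. good h e")
      case True
      then have "good h (b h)"
        unfolding b_def using someI_ex[of "good h"] by simp
      then show ?thesis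
        by (simp add: good_def)
    next
      case False
      then show ?thesis
        unfolding b_def using someI_ex[OF ex_legal_move, of h] by auto
    qed
  qed
  have len: "length (play b p m) = m" for p m
    by (induction m) (auto simp: Let_def)
  have "(\<exists>m \<le> n. builder_won (path_graph 3) (path_graph 3) (cycle_graph l) (play b p m)) \<or>
      win l (n - m) (play b p m)" if "m \<le> n" for p m
    using that
  proof (induction m)
    case 0
    then show ?case
      using assms by simp
  next
    case (Suc m)
    then consider "\<exists>m \<le> n. builder_won (path_graph 3) (path_graph 3) (cycle_graph l) (play b p m)"
      | "win l (n - m) (play b p m)"
      by auto
    then show ?case
    proof cases
      case 2
      define h where "h = play b p m"
      have nm: "n - m = Suc (n - Suc m)"
        using Suc.prems by simp
      from 2 consider "builder_won (path_graph 3) (path_graph 3) (cycle_graph l) h"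
        | e where "legal_move h e" "\<forall>c. win l (n - Suc m) (h @ [(e, c)])"
        unfolding nm h_def by auto
      then show ?thesis
      proof cases
        case 1
        then show ?thesis
          using Suc.prems h_def Suc_leD by blast
      next
        case 2
        then have "good h e"
          by (simp add: good_def h_def len)
        then have "good h (b h)"
          unfolding b_def using someI[of "good h" e] by auto
        then show ?thesis
          by (simp add: good_def h_def len Let_def)
      qed
    qed auto
  qed
  from this[of n] have "\<exists>m \<le> n. builder_won (path_graph 3) (path_graph 3) (cycle_graph l) (play b p m)"
    for p by fastforce
  then show ?thesis
    using legal by (auto simp: builder_wins_within_def)
qed

lemma contains_P3:
  assumes "{u, v} \<in> E" "{u, w} \<in> E" "v \<noteq> w" "u \<noteq> v" "u \<noteq> w"
  shows "contains_copy E (path_graph 3)"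
  unfolding contains_copy_def path_graph_def
proof (intro exI conjI)
  let ?f = "\<lambda>i::nat. if i = 0 then v else if i = 1 then u else w"
  show "inj_on ?f (fst ({0..<3}, {{i, i + 1} |i. i + 1 < 3}))"
    using assms by (auto simp: inj_on_def)
  have "?f ` {i, i + 1} \<in> E" if "i + 1 < 3" for i
  proof -
    have "i = 0 \<or> i = 1"
      using that by auto
    then show ?thesis
      using assms by (auto simp: insert_commute)
  qed
  then show "\<forall>e\<in>snd ({0..<3}, {{i, i + 1} |i. i + 1 < 3}). ?f ` e \<in> E"
    by auto
qed

text \<open>A second red or a second blue edge at a vertex completes a path on three vertices and
  ends the game, so only colours absent at both ends need an answer.\<close>

lemma step:
  assumes "a \<noteq> b" "\<not> drawn h a b" "win l n (draw h a b Green)"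
    and "\<And>c. c \<noteq> Green \<Longrightarrow> \<not> hit h c a \<Longrightarrow> \<not> hit h c b \<Longrightarrow> win l n (draw h a b c)"
  shows "win l (Suc n) h"
proof -
  have "win l n (draw h a b c)" for c
  proof (cases "c \<noteq> Green \<and> (hit h c a \<or> hit h c b)")
    case True
    then obtain u v x where uv: "{a, b} = {u, v}" "u \<noteq> v" "x \<noteq> u" "({u, x}, c) \<in> set h"
      using assms(1) by (auto simp: hit_def doubleton_eq_iff)
    then have "x \<noteq> v"
      using assms(2) by (force simp: drawn_def)
    then have "contains_copy (colour_class (draw h a b c) c) (path_graph 3)"
      using uv by (intro contains_P3[of u v _ x]) (auto simp: colour_class_def draw_def)
    then have "win l 0 (draw h a b c)"
      using True by (cases c) (auto simp: builder_won_def)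
    then show ?thesis
      by (rule win_mono) simp
  next
    case False
    then show ?thesis
      using assms by (cases c) auto
  qed
  moreover have "legal_move h {a, b}"
    using assms(1,2) by (auto simp: legal_move_def drawn_def)
  ultimately show ?thesis
    unfolding win.simps(2) draw_def by blast
qed

lemma drawn_draw [simp]: "drawn (draw h a b c) u v \<longleftrightarrow> drawn h u v \<or> u = a \<and> v = b \<or> u = b \<and> v = a"
  by (auto simp: draw_def drawn_def doubleton_eq_iff)

lemma green_draw [simp]:
  "green (draw h a b c) u v \<longleftrightarrow> green h u v \<or> c = Green \<and> (u = a \<and> v = b \<or> u = b \<and> v = a)"
  by (auto simp: draw_def green_def doubleton_eq_iff)

lemma hit_draw: "a \<noteq> b \<Longrightarrow> hit (draw h a b c) c' v \<longleftrightarrow> hit h c' v \<or> c' = c \<and> (v = a \<or> v = b)"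
  by (auto simp: draw_def hit_def doubleton_eq_iff)

lemma green_drawn: "green h u v \<Longrightarrow> drawn h u v"
  by (force simp: green_def drawn_def)

subsection \<open>Green and forced paths\<close>

lemma cost_Cons: "xs \<noteq> [] \<Longrightarrow> cost h (x # xs) = (if green h x (hd xs) then 0 else 1) + cost h xs"
  by (cases xs) auto

lemma cost_append:
  "xs \<noteq> [] \<Longrightarrow> ys \<noteq> [] \<Longrightarrow>
    cost h (xs @ ys) = cost h xs + cost h ys + (if green h (last xs) (hd ys) then 0 else 1)"
  by (induction xs rule: induct_list012) (auto simp: cost_Cons)

lemma cost_less_length: "xs \<noteq> [] \<Longrightarrow> cost h xs < length xs"
  by (induction h xs rule: cost.induct) auto

lemma cost_append_le: "cost h (xs @ ys) \<le> cost h xs + cost h ys + 1"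
  by (cases "xs = []"; cases "ys = []") (auto simp: cost_append)

lemma cost_rev [simp]: "cost h (rev xs) = cost h xs"
proof (induction xs)
  case (Cons x xs)
  then show ?case
    by (cases "xs = []") (auto simp: cost_Cons cost_append last_rev green_sym)
qed simp

lemma cost_mono:
  assumes "\<And>u v. green h u v \<Longrightarrow> green h' u v"
  shows "cost h' xs \<le> cost h xs"
  using assms by (induction h xs rule: cost.induct) (auto intro: le_SucI)

lemma cost_ext_le: "cost (draw h a b c) xs \<le> cost h xs"
  by (rule cost_mono) simp

lemma cost_less:
  assumes "\<And>u v. green h u v \<Longrightarrow> green h' u v"
    and "Suc i < length xs" "\<not> green h (xs ! i) (xs ! Suc i)" "green h' (xs ! i) (xs ! Suc i)"
  shows "cost h' xs < cost h xs"
  using assms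
proof (induction h xs arbitrary: i rule: cost.induct)
  case (1 h x y zs)
  show ?case
  proof (cases i)
    case 0
    then show ?thesis
      using 1 cost_mono[of h h' "y # zs"] by (auto simp: less_Suc_eq_le)
  next
    case (Suc j)
    then have "cost h' (y # zs) < cost h (y # zs)"
      using 1 by (intro "1.IH"[of j]) auto
    then show ?thesis
      using 1 by auto
  qed
qed auto

lemma cost_0: "cost h xs = 0 \<Longrightarrow> Suc i < length xs \<Longrightarrow> green h (xs ! i) (xs ! Suc i)"
proof (induction h xs arbitrary: i rule: cost.induct)
  case (1 h x y zs)
  then show ?case
    by (cases i) (auto split: if_splits)
qed auto

text \<open>Colours at a vertex only accumulate; the one threat to a forced edge is that this very
  edge is drawn red or blue.\<close>

lemma green_or_forced_draw: "green_or_forced h u v \<Longrightarrow> c = Green \<or> {u, v} \<noteq> {a, b} \<Longrightarrow> a \<noteq> b \<Longrightarrow> green_or_forced (draw h a b c) u v"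
  by (auto simp: green_or_forced_def hit_draw)

lemma won_if_green_cycle:
  assumes "distinct xs" "length xs = l" "3 \<le> l"
    and "\<And>i. Suc i < length (xs @ [hd xs]) \<Longrightarrow> green h ((xs @ [hd xs]) ! i) ((xs @ [hd xs]) ! Suc i)"
  shows "win l n h"
proof -
  have "contains_copy (colour_class h Green) (cycle_graph l)"
    unfolding contains_copy_def cycle_graph_def
  proof (intro exI conjI)
    show "inj_on (\<lambda>i. xs ! i) (fst ({0..<l}, {{i, (i + 1) mod l} |i. i < l}))"
      using assms by (auto simp: inj_on_def nth_eq_iff_index_eq)
    have "(\<lambda>i. xs ! i) ` {i, (i + 1) mod l} \<in> colour_class h Green" if "i < l" for i
    proof (cases "Suc i < l")
      case True
      then show ?thesis
        using assms(4)[of i] assms(2) that by (auto simp: colour_class_def green_def nth_append)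
    next
      case False
      then have "Suc i = l"
        using that by simp
      moreover have "hd xs = xs ! 0"
        using assms by (intro hd_conv_nth) auto
      ultimately show ?thesis
        using assms(4)[of i] assms(2) that
        by (auto simp: colour_class_def green_def nth_append)
    qed
    then show "\<forall>e\<in>snd ({0..<l}, {{i, (i + 1) mod l} |i. i < l}).
        (\<lambda>i. xs ! i) ` e \<in> colour_class h Green"
      by auto
  qed
  then have "win l 0 h"
    by (auto simp: builder_won_def)
  then show ?thesis
    by (rule win_mono) simp
qed

text \<open>Drawing one forced edge green leaves the others forced, so Builder draws the missing
  edges in any order and each round lowers the cost.\<close>

lemma win_cycle:
  assumes "distinct xs" "length xs = l" "3 \<le> l"
    and "successively (green_or_forced h) (xs @ [hd xs])" "cost h (xs @ [hd xs]) \<le> n"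
  shows "win l n h"
  using assms(4,5)
proof (induction n arbitrary: h)
  case 0
  show ?case
    using assms(1-3) by (rule won_if_green_cycle) (use 0 cost_0 in auto)
next
  case (Suc n)
  let ?ys = "xs @ [hd xs]"
  show ?case
  proof (cases "\<exists>i. Suc i < length ?ys \<and> \<not> green h (?ys ! i) (?ys ! Suc i)")
    case True
    then obtain i where i: "Suc i < length ?ys" "\<not> green h (?ys ! i) (?ys ! Suc i)"
      by auto
    define u v where "u = ?ys ! i" and "v = ?ys ! Suc i"
    have "green_or_forced h u v"
      using Suc.prems(1) i(1) unfolding successively_conv_nth u_def v_def by blast
    then have uv: "u \<noteq> v" "\<not> drawn h u v" "\<And>c. c \<noteq> Green \<Longrightarrow> hit h c u \<or> hit h c v"
      using i(2) by (auto simp: green_or_forced_def u_def v_def)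
    have "win l n (draw h u v Green)"
    proof (rule Suc.IH)
      show "successively (green_or_forced (draw h u v Green)) ?ys"
        by (rule successively_mono[OF Suc.prems(1)]) (use uv green_or_forced_draw in auto)
      have "cost (draw h u v Green) ?ys < cost h ?ys"
        by (rule cost_less[OF _ i]) (auto simp: u_def v_def)
      then show "cost (draw h u v Green) ?ys \<le> n"
        using Suc.prems(2) by simp
    qed
    then show ?thesis
      using uv by (intro step) auto
  next
    case False
    then show ?thesis
      by (intro won_if_green_cycle[OF assms(1-3)]) auto
  qed
qed

lemma gpath_Nil [simp]: "gpath h []"
  by (simp add: gpath_def)

lemma gpath_Cons: "gpath h (x # xs) \<longleftrightarrow> x \<notin> set xs \<and> gpath h xs \<and> (xs \<noteq> [] \<longrightarrow> green_or_forced h x (hd xs))"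
  by (cases xs) (auto simp: gpath_def)

lemma gpath_append:
  "gpath h (xs @ ys) \<longleftrightarrow> gpath h xs \<and> gpath h ys \<and> set xs \<inter> set ys = {} \<and>
     (xs \<noteq> [] \<and> ys \<noteq> [] \<longrightarrow> green_or_forced h (last xs) (hd ys))"
  by (auto simp: gpath_def successively_append_iff)

lemma gpath_rev [simp]: "gpath h (rev xs) \<longleftrightarrow> gpath h xs"
  using green_or_forced_sym by (simp add: gpath_def)

lemma gpath_draw:
  assumes "gpath h xs" "a \<notin> set xs \<or> b \<notin> set xs" "a \<noteq> b"
  shows "gpath (draw h a b c) xs"
  using assms
  by (induction xs) (auto simp: gpath_Cons doubleton_eq_iff intro!: green_or_forced_draw)

lemma close_cycle:
  assumes "gpath h xs" "length xs = l" "3 \<le> l" "green_or_forced h (last xs) (hd xs)" "cost h xs + 1 \<le> n"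
  shows "win l n h"
proof (rule win_cycle[OF _ assms(2,3)])
  have ne: "xs \<noteq> []"
    using assms(2,3) by auto
  show "distinct xs" "successively (green_or_forced h) (xs @ [hd xs])"
    using assms(1,4) ne by (auto simp: gpath_def successively_append_iff)
  show "cost h (xs @ [hd xs]) \<le> n"
    using assms(5) ne by (auto simp: cost_append)
qed

lemma close_cycle_green:
  assumes "gpath h xs" "length xs = l" "3 \<le> l" "green h (last xs) (hd xs)" "cost h xs \<le> n"
  shows "win l n h"
proof (rule win_cycle[OF _ assms(2,3)])
  have ne: "xs \<noteq> []"
    using assms(2,3) by auto
  show "distinct xs" "successively (green_or_forced h) (xs @ [hd xs])"
    using assms(1,4) ne by (auto simp: gpath_def successively_append_iff green_or_forced_def)
  show "cost h (xs @ [hd xs]) \<le> n"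
    using assms(4,5) ne by (auto simp: cost_append)
qed

lemma green_or_forced_iff:
  "green_or_forced h u v \<longleftrightarrow> green h u v \<or> u \<noteq> v \<and> \<not> drawn h u v \<and>
     (hit h Red u \<or> hit h Red v) \<and> (hit h Blue u \<or> hit h Blue v)"
proof -
  have "(\<forall>c. c \<noteq> Green \<longrightarrow> p c) \<longleftrightarrow> p Red \<and> p Blue" for p
    by (metis colour.distinct colour.exhaust)
  then show ?thesis
    by (simp add: green_or_forced_def)
qed

lemma forced_if_full: "full h u \<or> full h v \<Longrightarrow> u \<noteq> v \<Longrightarrow> \<not> drawn h u v \<Longrightarrow> green_or_forced h u v"
  unfolding green_or_forced_def by (metis colour.exhaust)

lemma forced_if_other:
  "hit h b u \<Longrightarrow> hit h (other b) v \<Longrightarrow> b \<noteq> Green \<Longrightarrow> u \<noteq> v \<Longrightarrow> \<not> drawn h u v \<Longrightarrow> green_or_forced h u v"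
  unfolding green_or_forced_def by (metis colour.exhaust other.simps(1,2))

lemma green_imp_green_or_forced: "green h u v \<Longrightarrow> green_or_forced h u v"
  by (simp add: green_or_forced_def)

lemma eq_other: "c \<noteq> Green \<Longrightarrow> b \<noteq> Green \<Longrightarrow> \<not> hit h c v \<Longrightarrow> hit h b v \<Longrightarrow> c = other b"
  by (metis colour.exhaust other.simps(1,2))

lemma other_other [simp]: "other (other c) = c"
  by (cases c) auto

lemma other_Green [simp]: "other c = Green \<longleftrightarrow> c = Green"
  by (cases c) auto

lemma full_other: "b \<noteq> Green \<Longrightarrow> hit h b v \<Longrightarrow> hit h (other b) v \<Longrightarrow> full h v"
  by (cases b) auto

lemma nbrs_in_draw: "nbrs_in h v S \<Longrightarrow> v \<noteq> a \<Longrightarrow> v \<noteq> b \<Longrightarrow> nbrs_in (draw h a b c) v S"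
  by (auto simp: nbrs_in_def)

lemma nbrs_in_mono: "nbrs_in h v S \<Longrightarrow> S \<subseteq> T \<Longrightarrow> nbrs_in h v T"
  by (auto simp: nbrs_in_def)

lemma nbrs_in_not_drawn: "nbrs_in h v S \<Longrightarrow> x \<notin> S \<Longrightarrow> \<not> drawn h v x \<and> \<not> drawn h x v"
  by (auto simp: nbrs_in_def drawn_sym)

subsection \<open>Closing a path that lacks one vertex\<close>

lemma hd_neq_last: "gpath h P \<Longrightarrow> 2 \<le> length P \<Longrightarrow> hd P \<noteq> last P"
  using last_in_set[of "tl P"] by (cases P) (auto simp: gpath_Cons)

text \<open>This is how often Painter can still refuse green at \<open>v\<close> without losing at
  once.\<close>

definition miss :: "history \<Rightarrow> nat \<Rightarrow> nat" where
  "miss h v = card {c. c \<noteq> Green \<and> \<not> hit h c v}"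

lemma miss_eq: "miss h v = (if hit h Red v then 0 else 1) + (if hit h Blue v then 0 else 1)"
proof -
  have "{c. c \<noteq> Green \<and> \<not> hit h c v} =
      (if hit h Red v then {} else {Red}) \<union> (if hit h Blue v then {} else {Blue})"
    (is "?A = ?B")
  proof (rule set_eqI)
    show "c \<in> ?A \<longleftrightarrow> c \<in> ?B" for c
      by (cases c) auto
  qed
  then show ?thesis
    by (simp add: miss_def)
qed

lemma miss_le_2: "miss h v \<le> 2"
  by (simp add: miss_eq)

lemma miss_le_1: "hit h b v \<Longrightarrow> b \<noteq> Green \<Longrightarrow> miss h v \<le> 1"
  by (cases b) (auto simp: miss_eq)

lemma miss_full: "full h v \<Longrightarrow> miss h v = 0"
  by (simp add: miss_eq)

lemma full_if_miss_0: "miss h v = 0 \<Longrightarrow> full h v"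
  by (auto simp: miss_eq split: if_splits)

lemma miss_draw:
  assumes "a \<noteq> b" "c \<noteq> Green" "\<not> hit h c v" "v = a \<or> v = b"
  shows "miss h v = Suc (miss (draw h a b c) v)"
  using assms by (cases c) (auto simp: miss_eq hit_draw)

lemma miss_draw_other: "a \<noteq> b \<Longrightarrow> v \<noteq> a \<Longrightarrow> v \<noteq> b \<or> c = Green \<Longrightarrow> miss (draw h a b c) v = miss h v"
  by (auto simp: miss_eq hit_draw)

lemma miss_draw_Green: "a \<noteq> b \<Longrightarrow> miss (draw h a b Green) v = miss h v"
  by (auto simp: miss_eq hit_draw)

text \<open>\<open>a\<close> and \<open>b\<close> count the colours missing at the two ends, \<open>s\<close> the green leaves at the first.\<close>

definition star_cost :: "nat \<Rightarrow> nat \<Rightarrow> nat \<Rightarrow> nat" where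
  "star_cost a b s = (if b = 0 then (if s = 0 then a + 2 else 1)
     else if a = 0 then (if s = 0 then b + 2 else b + 1)
     else 2 * (b + 1) - s + a - 1)"

text \<open>To close a green path that lacks one vertex, Builder first collects green leaves at one
  end and then tries to join them to the other end; each failure costs a colour there.\<close>

lemma star_close:
  assumes "gpath h P" "length P + 1 = l" "2 \<le> length P" "distinct S"
    and "\<And>t. t \<in> set S \<Longrightarrow> t \<notin> set P \<and> green h (hd P) t \<and> \<not> drawn h (last P) t"
    and "miss h (hd P) > 0 \<Longrightarrow> miss h (last P) > 0 \<Longrightarrow> length S \<le> miss h (last P) + 1"
    and "star_cost (miss h (hd P)) (miss h (last P)) (length S) + cost h P \<le> n"
  shows "win l n h"
  using assms(1,4-)
proof (induction n arbitrary: h S)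
  case 0
  then show ?case
    by (auto simp: star_cost_def split: if_splits)
next
  case (Suc n)
  define x y where "x = hd P" and "y = last P"
  have "P \<noteq> []"
    using assms(3) by auto
  then have P: "P \<noteq> []" "x \<in> set P" "y \<in> set P" "x \<noteq> y"
    using hd_neq_last[OF Suc.prems(1) assms(3)] unfolding x_def y_def by auto
  note fr = ex_fresh[of "set P \<union> set S" h thesis for thesis]
  have l: "length (P @ [t]) = l" "3 \<le> l" for t
    using assms(2,3) by auto
  consider (fin) "miss h y = 0" "S \<noteq> []" | (both) "miss h x = 0" "miss h y = 0" "S = []"
    | (one) "miss h x > 0" "miss h y = 0" "S = []" | (full) "miss h x = 0" "miss h y > 0"
    | (leaf) "miss h x > 0" "miss h y > 0" "length S \<le> miss h y"
    | (join) "miss h x > 0" "miss h y > 0" "length S = Suc (miss h y)"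
    using Suc.prems(4) x_def y_def by fastforce
  then show ?case
  proof cases
    case fin
    then obtain t where "t \<in> set S"
      by (cases S) auto
    then have "t \<notin> set P" "green h t x" "\<not> drawn h y t" "y \<noteq> t"
      using Suc.prems(3)[of t] P by (auto simp: x_def y_def green_sym)
    then show ?thesis
      using fin Suc.prems full_if_miss_0[of h y] P cost_append_le[of h P "[t]"]
      by (intro close_cycle_green[of h "P @ [t]", OF _ l])
        (auto simp: gpath_append gpath_Cons x_def y_def star_cost_def green_sym intro!: forced_if_full)
  next
    case both
    obtain t where t: "t \<notin> set P \<union> set S" "\<And>y. \<not> drawn h t y" "\<And>y. \<not> drawn h y t"
      by (rule fr) auto
    then show ?thesis
      using both Suc.prems full_if_miss_0[of h y] full_if_miss_0[of h x] P cost_append_le[of h P "[t]"]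
      by (intro close_cycle[of h "P @ [t]", OF _ l])
        (auto simp: gpath_append gpath_Cons x_def y_def star_cost_def intro!: forced_if_full)
  next
    \<comment> \<open>As the last end is full, a single green leaf at the first end
      suffices.\<close>
    case one
    obtain t where t: "t \<notin> set P \<union> set S" "\<And>y. \<not> drawn h t y" "\<And>y. \<not> drawn h y t"
      by (rule fr) auto
    then have "x \<noteq> t" "y \<noteq> t"
      using P by auto
    show ?thesis
    proof (rule step[of x t])
      show "win l n (draw h x t Green)"
        using one t P Suc.prems \<open>x \<noteq> t\<close> \<open>y \<noteq> t\<close> cost_ext_le[of h x t Green P]
        by (intro Suc.IH[of _ "[t]"])
          (auto simp: x_def[symmetric] y_def[symmetric] star_cost_def miss_draw_Green intro!: gpath_draw)
      show "win l n (draw h x t c)" if "c \<noteq> Green" "\<not> hit h c x" for c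
        using one t P Suc.prems \<open>x \<noteq> t\<close> \<open>y \<noteq> t\<close> cost_ext_le[of h x t c P]
          miss_draw[of x t c h x] miss_draw_other[of x t y c h] that
        by (intro Suc.IH[of _ "[]"])
          (auto simp: x_def[symmetric] y_def[symmetric] star_cost_def intro!: gpath_draw)
    qed (use t \<open>x \<noteq> t\<close> in auto)
  next
    \<comment> \<open>As the first end is full, any green edge at the last end closes the cycle, so
      a fresh vertex serves as well as an old leaf.\<close>
    case full
    obtain t where t: "t \<notin> set P \<union> set S" "\<And>y. \<not> drawn h t y" "\<And>y. \<not> drawn h y t"
      by (rule fr) auto
    then have ne: "x \<noteq> t" "y \<noteq> t" "\<And>s. s \<in> set S \<Longrightarrow> s \<noteq> t"
      using P by auto
    show ?thesis
    proof (rule step[of y t])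
      have "cost (draw h y t Green) (P @ [t]) = cost (draw h y t Green) P"
        using P by (simp add: cost_append y_def)
      moreover have "green_or_forced (draw h y t Green) y t" "green_or_forced (draw h y t Green) t x"
        using full_if_miss_0[OF full(1)] ne t P by (auto simp: hit_draw green_or_forced_iff)
      ultimately show "win l n (draw h y t Green)"
        using full t P Suc.prems ne cost_ext_le[of h y t Green P]
        by (intro close_cycle[of _ "P @ [t]", OF _ l])
          (auto simp: gpath_append gpath_Cons x_def[symmetric] y_def[symmetric] star_cost_def
            intro!: gpath_draw split: if_splits)
      show "win l n (draw h y t c)" if "c \<noteq> Green" "\<not> hit h c y" for c
        using full t P Suc.prems ne cost_ext_le[of h y t c P]
          miss_draw[of y t c h y] miss_draw_other[of y t x c h] that
        by (intro Suc.IH[of _ S])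
          (auto simp: x_def[symmetric] y_def[symmetric] star_cost_def intro!: gpath_draw split: if_splits)
    qed (use t ne in auto)
  next
    \<comment> \<open>At most \<open>b\<close> refusals are possible at the last end, so
      \<open>b + 1\<close> leaves suffice: \<open>b + 1\<close> rounds to collect them, as many to
      join them, and \<open>a\<close> refusals. The \<open>- 1\<close> in \<open>star_cost\<close>
      is the round saved because the \<open>a\<close>-th refusal makes the first end full and leads
      to the cheaper case \<open>full\<close>.\<close>
    case leaf
    obtain t where t: "t \<notin> set P \<union> set S" "\<And>y. \<not> drawn h t y" "\<And>y. \<not> drawn h y t"
      by (rule fr) auto
    then have ne: "x \<noteq> t" "y \<noteq> t" "\<And>s. s \<in> set S \<Longrightarrow> s \<noteq> t"
      using P by auto
    show ?thesis
    proof (rule step[of x t])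
      show "win l n (draw h x t Green)"
        using leaf t P Suc.prems ne cost_ext_le[of h x t Green P]
        by (intro Suc.IH[of _ "t # S"])
          (auto simp: x_def[symmetric] y_def[symmetric] star_cost_def miss_draw_Green intro!: gpath_draw)
      show "win l n (draw h x t c)" if "c \<noteq> Green" "\<not> hit h c x" for c
        using leaf t P Suc.prems ne cost_ext_le[of h x t c P]
          miss_draw[of x t c h x] miss_draw_other[of x t y c h] that
        by (intro Suc.IH[of _ S])
          (auto simp: x_def[symmetric] y_def[symmetric] star_cost_def intro!: gpath_draw split: if_splits)
    qed (use t ne in auto)
  next
    case join
    then obtain t S' where S: "S = t # S'"
      by (cases S) auto
    have t: "t \<notin> set P" "green h x t" "\<not> drawn h y t"
      using Suc.prems(3)[of t] by (simp_all add: S x_def y_def)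
    then have t: "t \<notin> set P" "green h x t" "\<not> drawn h y t" "x \<noteq> t" "y \<noteq> t" "t \<notin> set S'"
      using Suc.prems(2) P S by auto
    show ?thesis
    proof (rule step[of y t])
      have "cost (draw h y t Green) (P @ [t]) = cost (draw h y t Green) P"
        using P by (simp add: cost_append y_def)
      moreover have "green_or_forced (draw h y t Green) y t" "green (draw h y t Green) t x"
        using t by (auto simp: green_sym intro: green_imp_green_or_forced)
      ultimately show "win l n (draw h y t Green)"
        using t P Suc.prems join cost_ext_le[of h y t Green P]
        by (intro close_cycle_green[of _ "P @ [t]", OF _ l])
          (auto simp: gpath_append gpath_Cons x_def[symmetric] y_def[symmetric] star_cost_def
            intro!: gpath_draw)
      show "win l n (draw h y t c)" if "c \<noteq> Green" "\<not> hit h c y" for c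
        using join t P Suc.prems S cost_ext_le[of h y t c P]
          miss_draw[of y t c h y] miss_draw_other[of y t x c h] that
        by (intro Suc.IH[of _ S'])
          (auto simp: x_def[symmetric] y_def[symmetric] star_cost_def intro!: gpath_draw split: if_splits)
    qed (use t in auto)
  qed
qed

subsection \<open>Builder moves at a fresh vertex\<close>

lemma step_pred:
  assumes "0 < n" "a \<noteq> b" "\<not> drawn h a b" "win l (n - 1) (draw h a b Green)"
    and "\<And>c. c \<noteq> Green \<Longrightarrow> \<not> hit h c a \<Longrightarrow> \<not> hit h c b \<Longrightarrow> win l (n - 1) (draw h a b c)"
  shows "win l n h"
  using step[of a b h l "n - 1"] assms by simp

text \<open>Every new edge that meets \<open>S\<close> joins \<open>a\<close> to a vertex outside \<open>S\<close>.\<close>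

definition grows :: "history \<Rightarrow> history \<Rightarrow> nat \<Rightarrow> nat set \<Rightarrow> bool" where
  "grows h h' a S \<longleftrightarrow> (\<forall>u v. green h u v \<longrightarrow> green h' u v) \<and> (\<forall>b u. hit h b u \<longrightarrow> hit h' b u) \<and>
     (\<forall>u \<in> S. \<forall>v. drawn h' u v \<longrightarrow> drawn h u v \<or> u = a \<and> v \<notin> S)"

lemma grows_draw:
  assumes "u \<notin> S" "a \<in> S"
  shows "grows h (draw h a u c) a S"
proof -
  have "a \<noteq> u"
    using assms by auto
  then show ?thesis
    using assms by (auto simp: grows_def hit_draw)
qed

lemma grows_trans: "grows h h' a S \<Longrightarrow> grows h' h'' a S \<Longrightarrow> grows h h'' a S"
  unfolding grows_def by blast

lemma grows_green: "grows h h' a S \<Longrightarrow> green h u v \<Longrightarrow> green h' u v"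
  by (simp add: grows_def)

lemma grows_hit: "grows h h' a S \<Longrightarrow> hit h b u \<Longrightarrow> hit h' b u"
  by (simp add: grows_def)

lemma grows_drawn: "grows h h' a S \<Longrightarrow> u \<in> S \<Longrightarrow> v \<in> S \<Longrightarrow> \<not> drawn h u v \<Longrightarrow> \<not> drawn h' u v"
  unfolding grows_def by blast

lemma grows_nbrs_in: "grows h h' a S \<Longrightarrow> nbrs_in h u T \<Longrightarrow> u \<in> S \<Longrightarrow> u \<noteq> a \<Longrightarrow> nbrs_in h' u T"
  unfolding grows_def nbrs_in_def by blast

lemma grows_cost: "grows h h' a S \<Longrightarrow> cost h' xs \<le> cost h xs"
  by (rule cost_mono) (simp add: grows_green)

lemma grows_gpath: "grows h h' a S \<Longrightarrow> gpath h xs \<Longrightarrow> set xs \<subseteq> S \<Longrightarrow> gpath h' xs"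
proof (induction xs)
  case (Cons x xs)
  have "green_or_forced h' x y" if "green_or_forced h x y" "y \<in> S" for y
    using that Cons.prems grows_green[OF Cons.prems(1)] grows_hit[OF Cons.prems(1)]
      grows_drawn[OF Cons.prems(1), of x y] by (auto simp: green_or_forced_iff)
  moreover have "hd xs \<in> S" if "xs \<noteq> []"
    using Cons.prems(3) that by (cases xs) auto
  ultimately show ?case
    using Cons by (auto simp: gpath_Cons)
qed simp

text \<open>The basic move, packaged so that later arguments see only \<open>grows\<close> and the
  state of the fresh vertex.\<close>

lemma sprout:
  assumes "0 < n" "finite S" "a \<in> S"
    and "\<And>h' u. u \<notin> S \<Longrightarrow> grows h h' a S \<Longrightarrow> nbrs_in h' u {a} \<Longrightarrow> green h' a u \<Longrightarrow> win l (n - 1) h'"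
    and "\<And>h' u b. u \<notin> S \<Longrightarrow> grows h h' a S \<Longrightarrow> nbrs_in h' u {a} \<Longrightarrow> b \<noteq> Green \<Longrightarrow> \<not> hit h b a \<Longrightarrow>
      hit h' b a \<Longrightarrow> hit h' b u \<Longrightarrow> win l (n - 1) h'"
  shows "win l n h"
proof -
  obtain u where u: "u \<notin> S" "\<And>y. \<not> drawn h u y" "\<And>y. \<not> drawn h y u"
    by (rule ex_fresh[OF assms(2), of h]) auto
  then have au: "a \<noteq> u"
    using assms(3) by auto
  have nbrs_in: "nbrs_in (draw h a u c) u {a}" for c
    using u by (auto simp: nbrs_in_def)
  show ?thesis
  proof (rule step_pred[OF assms(1) au])
    show "win l (n - 1) (draw h a u Green)"
      using u au nbrs_in assms(3) by (intro assms(4)[of u]) (auto intro: grows_draw)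
    show "win l (n - 1) (draw h a u c)" if "c \<noteq> Green" "\<not> hit h c a" for c
      using u au nbrs_in assms(3) that by (intro assms(5)[of u _ c]) (auto intro: grows_draw simp: hit_draw)
  qed (use u in auto)
qed

text \<open>Builder draws two edges at the half vertex \<open>c\<close>, stopping if the first is
  coloured. The equation for \<open>m\<close> unites the two ways in which \<open>c\<close> becomes
  full: if the first edge is coloured, one round is gone and the edge from \<open>c\<close> to
  \<open>z\<close> is still undrawn; if the second is, two rounds are gone but that edge is already
  green.\<close>

lemma probe:
  assumes "2 \<le> n" "finite S" "c \<in> S" "hit h b c" "b \<noteq> Green"
    and N: "\<And>h' z e m. z \<notin> S \<Longrightarrow> e \<notin> S \<Longrightarrow> z \<noteq> e \<Longrightarrow> grows h h' c S \<Longrightarrow> full h' c \<Longrightarrow> green_or_forced h' c z \<Longrightarrow>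
      nbrs_in h' z {c} \<Longrightarrow> nbrs_in h' e {c} \<Longrightarrow> hit h' (other b) e \<Longrightarrow> m + 2 = n + cost h' [c, z] \<Longrightarrow> win l m h'"
    and G: "\<And>h' u y. u \<notin> S \<Longrightarrow> y \<notin> S \<Longrightarrow> u \<noteq> y \<Longrightarrow> grows h h' c S \<Longrightarrow> green h' c y \<Longrightarrow> green h' c u \<Longrightarrow>
      nbrs_in h' u {c} \<Longrightarrow> nbrs_in h' y {c} \<Longrightarrow> win l (n - 2) h'"
  shows "win l n h"
proof -
  obtain y where y: "y \<notin> S" "\<And>x. \<not> drawn h y x" "\<And>x. \<not> drawn h x y"
    by (rule ex_fresh[OF assms(2), of h]) auto
  obtain s where "s \<notin> insert y S" and s: "\<And>x. \<not> drawn h s x" "\<And>x. \<not> drawn h x s"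
    by (rule ex_fresh[of "insert y S" h]) (use assms(2) in auto)
  then have ne: "y \<noteq> s" "c \<noteq> y" "c \<noteq> s" "s \<notin> S" "y \<notin> S"
    using y assms(3) by auto
  have eq: "x = other b" if "x \<noteq> Green" "\<not> hit h x c" for x
    using eq_other[OF that(1) assms(5) that(2) assms(4)] .
  show ?thesis
  proof (rule step_pred[of n c y])
    fix x
    assume x: "x \<noteq> Green" "\<not> hit h x c" "\<not> hit h x y"
    let ?h = "draw h c y (other b)"
    have full: "full ?h c"
      using assms(4,5) ne by (intro full_other[of b]) (auto simp: hit_draw)
    have "\<not> green ?h c s"
      using s ne assms(5) by (auto dest: green_drawn)
    moreover have "green_or_forced ?h c s"
      using full s ne by (auto simp: green_or_forced_iff)
    ultimately have "win l (n - 1) ?h"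
      using full y s ne assms
      by (intro N[of s y]) (auto simp: nbrs_in_def hit_draw intro: grows_draw)
    then show "win l (n - 1) (draw h c y x)"
      using eq x by simp
  next
    let ?h = "draw h c y Green"
    show "win l (n - 1) ?h"
    proof (rule step_pred[of "n - 1" c s])
      have u: "grows h (draw ?h c s x) c S" for x
        using grows_trans[of h ?h c S "draw ?h c s x"] grows_draw ne assms(3) by blast
      show "win l (n - 1 - 1) (draw ?h c s Green)"
        using u ne y s by (simp only: diff_diff_left one_add_one, intro G[of s y]) (auto simp: nbrs_in_def)
      fix x
      assume x: "x \<noteq> Green" "\<not> hit ?h x c" "\<not> hit ?h x s"
      let ?h' = "draw ?h c s (other b)"
      have full: "full ?h' c"
        using assms(4,5) ne by (intro full_other[of b]) (auto simp: hit_draw)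
      have "green_or_forced ?h' c y"
        by (simp add: green_or_forced_iff)
      then have "win l (n - 1 - 1) ?h'"
        using full y s ne assms u
        by (intro N[of y s]) (auto simp: nbrs_in_def hit_draw)
      then show "win l (n - 1 - 1) (draw ?h c s x)"
        using eq x ne by (simp add: hit_draw)
    qed (use assms(1) s ne in auto)
  qed (use assms(1) y ne in auto)
qed

section \<open>Banks\<close>

abbreviation joint :: "nat list \<Rightarrow> nat" where
  "joint K \<equiv> (if K = [] then 0 else 1)"

text \<open>Since the last vertex is adjacent only to vertices of \<open>K\<close>, its edge to any
  full vertex outside is undrawn and hence forced: a bank can be hooked onto any full vertex. The
  empty list encodes that there is no bank.\<close>

definition bank :: "history \<Rightarrow> nat list \<Rightarrow> bool" where
  "bank h K \<longleftrightarrow> K = [] \<or> gpath h K \<and> full h (hd K) \<and> nbrs_in h (last K) (set K)"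

lemma bank_Nil [simp]: "bank h []"
  by (simp add: bank_def)

lemma bank_gpath: "bank h K \<Longrightarrow> gpath h K"
  by (auto simp: bank_def)

lemma bank_grows:
  assumes "bank h K" "grows h h' a S" "set K \<subseteq> S" "a \<notin> set K"
  shows "bank h' K"
proof (cases "K = []")
  case False
  then have "last K \<in> set K"
    by simp
  then have "last K \<in> S" "last K \<noteq> a"
    using assms(3,4) by auto
  then show ?thesis
    using assms False grows_gpath grows_hit grows_nbrs_in unfolding bank_def by blast
qed simp

text \<open>The full vertex \<open>c\<close> hooks onto the old free end, and \<open>z\<close>,
  whose only neighbour \<open>c\<close> now lies on the path, becomes the new one.\<close>

lemma bank_snoc:
  assumes "bank h K" "full h c" "c \<notin> set K" "z \<notin> set K" "c \<noteq> z" "green_or_forced h c z" "nbrs_in h z {c}"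
  shows "bank h (K @ [c, z])" "cost h (K @ [c, z]) \<le> cost h K + joint K + cost h [c, z]"
proof -
  have "green_or_forced h (last K) c" if "K \<noteq> []"
  proof -
    have "last K \<noteq> c"
      using assms(3) that by (metis last_in_set)
    moreover have "\<not> drawn h (last K) c"
      using assms(1,3) that by (auto simp: bank_def nbrs_in_def)
    ultimately show ?thesis
      using assms(2) by (auto simp: green_or_forced_iff)
  qed
  then show "bank h (K @ [c, z])"
    using assms by (cases "K = []") (auto simp: bank_def gpath_append gpath_Cons nbrs_in_def)
  show "cost h (K @ [c, z]) \<le> cost h K + joint K + cost h [c, z]"
    by (cases "K = []") (auto simp: cost_append)
qed

lemma last_bank_undrawn: "bank h K \<Longrightarrow> K \<noteq> [] \<Longrightarrow> x \<notin> set K \<Longrightarrow> \<not> drawn h (last K) x \<and> \<not> drawn h x (last K)"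
  by (auto simp: bank_def nbrs_in_def drawn_sym)

text \<open>Attached in reverse, the bank hands its full head to \<open>P\<close> as the new end, so
  the types of the ends do not change.\<close>

lemma merge:
  assumes "gpath h P" "P \<noteq> []" "full h (last P)" "bank h K" "set P \<inter> set K = {}"
  shows "gpath h (P @ rev K)" "full h (last (P @ rev K))" "cost h (P @ rev K) \<le> cost h P + cost h K + joint K"
proof -
  have "green_or_forced h (last P) (last K)" if "K \<noteq> []"
  proof -
    have "last P \<notin> set K" "last K \<in> set K"
      using assms(2,5) that last_in_set by fastforce+
    then show ?thesis
      using assms(3) last_bank_undrawn[OF assms(4) that, of "last P"] by (auto simp: green_or_forced_iff)
  qed
  then show "gpath h (P @ rev K)"
    using assms by (auto simp: gpath_append bank_gpath hd_rev)
  show "full h (last (P @ rev K))"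
    using assms by (cases "K = []") (auto simp: bank_def last_rev)
  show "cost h (P @ rev K) \<le> cost h P + cost h K + joint K"
    using assms(2) by (cases "K = []") (auto simp: cost_append)
qed

text \<open>The constant 3 is \<open>star_cost 1 0 0\<close>: one refusal at the half end, one green
  leaf, one forced edge.\<close>

lemma close_half_full:
  assumes "gpath h P" "2 \<le> length P" "hit h b (hd P)" "b \<noteq> Green" "full h (last P)" "bank h K"
    "set P \<inter> set K = {}" "length P + length K + 1 = l" "3 + joint K + cost h P + cost h K \<le> n"
  shows "win l n h"
proof -
  have ne: "P \<noteq> []"
    using assms(2) by auto
  note m = merge[OF assms(1) ne assms(5-7)]
  show ?thesis
    using m assms(2-4,8,9) ne miss_le_1[of h b "hd P"] miss_full[OF m(2)]
    by (intro star_close[OF m(1), of l "[]"]) (auto simp: star_cost_def)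
qed

subsection \<open>Paths with a full end\<close>

text \<open>The inequalities say \<open>D \<le> 2r + const\<close>, where \<open>r\<close> is the number of remaining rounds that need
  not contribute to the cycle; \<open>r\<close> has been eliminated in favour of \<open>n\<close>. Without a bank one more
  unit of slack is required.\<close>

definition full_full_plus :: "nat \<Rightarrow> history \<Rightarrow> nat list \<Rightarrow> nat list \<Rightarrow> nat \<Rightarrow> nat \<Rightarrow> bool" where
  "full_full_plus l h P K c n \<longleftrightarrow> gpath h P \<and> P \<noteq> [] \<and> full h (hd P) \<and> full h (last P) \<and> bank h K \<and>
     set P \<inter> set K = {} \<and> c \<notin> set P \<union> set K \<and> (\<exists>b. b \<noteq> Green \<and> hit h b c) \<and>
     \<not> drawn h c (hd P) \<and> (K = [] \<longrightarrow> 2 \<le> length P) \<and>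
     (\<exists>D. 1 \<le> D \<and> length P + length K + D = l \<and> 3 * D + 2 + joint K + 2 * (cost h P + cost h K) \<le> 2 * n)"

definition half_full :: "nat \<Rightarrow> history \<Rightarrow> nat list \<Rightarrow> nat list \<Rightarrow> nat \<Rightarrow> bool" where
  "half_full l h P K n \<longleftrightarrow> gpath h P \<and> 2 \<le> length P \<and> (\<exists>b. b \<noteq> Green \<and> hit h b (hd P)) \<and> full h (last P) \<and>
     bank h K \<and> set P \<inter> set K = {} \<and>
     (\<exists>D. 1 \<le> D \<and> length P + length K + D = l \<and> 3 * D + 4 + joint K + 2 * (cost h P + cost h K) \<le> 2 * n)"

text \<open>Excluding \<open>last P\<close> keeps the edge between the two ends undrawn. It closes
  the cycle if no vertex is missing, a case that only this position allows.\<close>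

definition free_full :: "nat \<Rightarrow> history \<Rightarrow> nat list \<Rightarrow> nat list \<Rightarrow> nat \<Rightarrow> bool" where
  "free_full l h P K n \<longleftrightarrow> gpath h P \<and> 3 \<le> length P \<and> nbrs_in h (hd P) (set P - {last P}) \<and> full h (last P) \<and>
     bank h K \<and> set P \<inter> set K = {} \<and>
     (\<exists>D. length P + length K + D = l \<and> 3 * D + 5 + joint K + 2 * (cost h P + cost h K) \<le> 2 * n)"

text \<open>It matters that \<open>c\<close> and the half end share a colour. If two vertices are
  missing and there is a bank, only one spare round is guaranteed; the final condition keeps undrawn
  the edges through which the cycle is then closed. Its disjunction serves two origins:
  \<open>c\<close> may have arisen from a refused edge at \<open>hd P\<close>, or independently of
  \<open>hd P\<close>.\<close>

definition half_full_plus :: "nat \<Rightarrow> history \<Rightarrow> nat list \<Rightarrow> nat list \<Rightarrow> nat \<Rightarrow> nat \<Rightarrow> bool" where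
  "half_full_plus l h P K c n \<longleftrightarrow> gpath h P \<and> 2 \<le> length P \<and> (\<exists>b. b \<noteq> Green \<and> hit h b (hd P) \<and> hit h b c) \<and>
     full h (last P) \<and> bank h K \<and> set P \<inter> set K = {} \<and> c \<notin> set P \<union> set K \<and>
     (\<exists>D. 1 \<le> D \<and> length P + length K + D = l \<and> 3 * D + 3 + joint K + 2 * (cost h P + cost h K) \<le> 2 * n \<and>
       (D = 2 \<longrightarrow> K \<noteq> [] \<longrightarrow> (\<not> drawn h (hd P) c \<or> \<not> drawn h (hd P) (hd K)) \<and> \<not> drawn h c (hd K)))"

text \<open>Probing \<open>c\<close> loses nothing when there is a bank:
  \<open>D \<le> 2r + 1\<close> becomes \<open>D - 2 \<le> 2(r - 1) + 1\<close> if the bank grows,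
  and \<open>D - 3 \<le> 2r - 2\<close> if a green path on three vertices is hooked onto the full
  head.\<close>

lemma full_full_plus_win:
  assumes IH: "\<And>m h P K c. m < n \<Longrightarrow> full_full_plus l h P K c m \<Longrightarrow> win l m h"
    and IH0: "\<And>m h P K. m < n \<Longrightarrow> free_full l h P K m \<Longrightarrow> win l m h"
    and st: "full_full_plus l h P K c n"
  shows "win l n h"
proof -
  from st obtain b D where P: "gpath h P" "P \<noteq> []" "full h (hd P)" "full h (last P)" and K: "bank h K"
    and dis: "set P \<inter> set K = {}" "c \<notin> set P" "c \<notin> set K"
    and c: "b \<noteq> Green" "hit h b c" "\<not> drawn h c (hd P)" and P2: "K = [] \<longrightarrow> 2 \<le> length P"
    and D: "1 \<le> D" "length P + length K + D = l" "3 * D + 2 + joint K + 2 * (cost h P + cost h K) \<le> 2 * n"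
    by (auto simp: full_full_plus_def)
  have mem: "hd P \<in> set P" "last P \<in> set P"
    using P(2) by auto
  consider "D = 1" | "D = 2" | "D \<ge> 3"
    using D(1) by linarith
  then show ?thesis
  proof cases
    case 1
    obtain s where s: "s \<notin> set P \<union> set K" "\<And>y. \<not> drawn h s y" "\<And>y. \<not> drawn h y s"
      by (rule ex_fresh[of "set P \<union> set K" h]) auto
    let ?X = "P @ rev K"
    note m = merge[OF P(1,2,4) K dis(1)]
    have ne: "s \<noteq> hd P" "s \<noteq> last ?X"
      using s(1) mem P(2) last_in_set[of ?X] by auto
    have "gpath h (?X @ [s])"
      using m s ne P(2) by (subst gpath_append) (auto simp: gpath_Cons green_or_forced_iff)
    moreover have "green_or_forced h (last (?X @ [s])) (hd (?X @ [s]))"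
      using P s ne by (simp add: green_or_forced_iff)
    moreover have "3 \<le> l"
      using D(2) P2 P(2) 1 by (cases P; cases K) auto
    ultimately show ?thesis
      using 1 D m(3) cost_append_le[of h ?X "[s]"]
      by (intro close_cycle[of h "?X @ [s]"]) (auto split: if_splits)
  next
    case 2
    have "c \<noteq> hd P"
      using mem dis by auto
    then have "gpath h (c # P)"
      using P dis c by (auto simp: gpath_Cons green_or_forced_iff)
    then show ?thesis
      using 2 P K dis c D P(2) cost_Cons[OF P(2), of h c] mem
      by (intro close_half_full[of h "c # P" b K]) (auto split: if_splits simp: Suc_le_eq)
  next
    case 3
    let ?S = "insert c (set P \<union> set K)"
    show ?thesis
    proof (rule probe[of n ?S c h b])
      fix h' z e m
      assume a: "z \<notin> ?S" "e \<notin> ?S" "z \<noteq> e" "grows h h' c ?S" "full h' c" "green_or_forced h' c z" "nbrs_in h' z {c}"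
        "nbrs_in h' e {c}" "hit h' (other b) e" "m + 2 = n + cost h' [c, z]"
      have "bank h' K"
        using bank_grows[OF K a(4)] dis by auto
      note K' = bank_snoc[OF this a(5) dis(3) _ _ a(6,7)]
      have "full_full_plus l h' P (K @ [c, z]) e m"
        unfolding full_full_plus_def
      proof (intro conjI exI[of _ "D - 2"])
        show "gpath h' P"
          using grows_gpath[OF a(4) P(1)] by auto
        show "hit h' Red (hd P)" "hit h' Blue (hd P)" "hit h' Red (last P)" "hit h' Blue (last P)"
          using P grows_hit[OF a(4)] by auto
        show "\<exists>b. b \<noteq> Green \<and> hit h' b e"
          using a(9) c(1) by (intro exI[of _ "other b"]) auto
        show "\<not> drawn h' e (hd P)"
          using a(8) mem dis by (auto simp: nbrs_in_def)
        show "3 * (D - 2) + 2 + joint (K @ [c, z]) + 2 * (cost h' P + cost h' (K @ [c, z])) \<le> 2 * m"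
          using K'(2) D(3) 3 a(1,10) grows_cost[OF a(4), of P] grows_cost[OF a(4), of K] by (auto split: if_splits)
      qed (use 3 D K' P a dis in auto)
      then show "win l m h'"
        using a(10) by (intro IH) (auto split: if_splits)
    next
      fix h' u y
      assume a: "u \<notin> ?S" "y \<notin> ?S" "u \<noteq> y" "grows h h' c ?S" "green h' c y" "green h' c u"
        "nbrs_in h' u {c}" "nbrs_in h' y {c}"
      have yP: "green_or_forced h' y (hd P)"
        using a mem P dis grows_hit[OF a(4)] by (auto simp: green_or_forced_iff nbrs_in_def)
      have "free_full l h' (u # c # y # P) K (n - 2)"
        unfolding free_full_def
      proof (intro conjI exI[of _ "D - 3"])
        show "gpath h' (u # c # y # P)"
          using grows_gpath[OF a(4) P(1)] a dis yP by (auto simp: gpath_Cons green_or_forced_iff green_sym)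
        show "nbrs_in h' (hd (u # c # y # P)) (set (u # c # y # P) - {last (u # c # y # P)})"
          using a(7) mem dis P(2) by (auto simp: nbrs_in_def)
        show "bank h' K"
          using bank_grows[OF K a(4)] dis by auto
        have "cost h' (u # c # y # P) \<le> 1 + cost h P"
          using a(5,6) P(2) grows_cost[OF a(4), of P] by (auto simp: cost_Cons green_sym)
        then show "3 * (D - 3) + 5 + joint K + 2 * (cost h' (u # c # y # P) + cost h' K) \<le> 2 * (n - 2)"
          using D(3) 3 grows_cost[OF a(4), of K] by (auto split: if_splits)
      qed (use 3 D P a dis grows_hit[OF a(4)] in auto)
      then show "win l (n - 2) h'"
        using D 3 by (intro IH0) auto
    qed (use D 3 c in auto)
  qed
qed

text \<open>A green edge at the half end adds a vertex and leaves a free end; a coloured one makes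
  that end full and creates a new half vertex \<open>c\<close>.\<close>

lemma half_full_win:
  assumes IH: "\<And>m h P K c. m < n \<Longrightarrow> full_full_plus l h P K c m \<Longrightarrow> win l m h"
    and IH0: "\<And>m h P K. m < n \<Longrightarrow> free_full l h P K m \<Longrightarrow> win l m h"
    and st: "half_full l h P K n"
  shows "win l n h"
proof -
  from st obtain b D where P: "gpath h P" "2 \<le> length P" "b \<noteq> Green" "hit h b (hd P)" "full h (last P)"
    and K: "bank h K" and dis: "set P \<inter> set K = {}"
    and D: "1 \<le> D" "length P + length K + D = l" "3 * D + 4 + joint K + 2 * (cost h P + cost h K) \<le> 2 * n"
    by (auto simp: half_full_def)
  have ne: "P \<noteq> []"
    using P(2) by auto
  then have mem: "hd P \<in> set P" "last P \<in> set P" "hd P \<noteq> last P"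
    using hd_neq_last[OF P(1,2)] by auto
  show ?thesis
  proof (cases "D = 1")
    case True
    then show ?thesis
      using P K dis D by (intro close_half_full[of h P b K]) (auto split: if_splits)
  next
    case False
    let ?S = "set P \<union> set K"
    show ?thesis
    proof (rule sprout[of n ?S "hd P" h])
      fix h' u
      assume a: "u \<notin> ?S" "grows h h' (hd P) ?S" "nbrs_in h' u {hd P}" "green h' (hd P) u"
      have "free_full l h' (u # P) K (n - 1)"
        unfolding free_full_def
      proof (intro conjI exI[of _ "D - 1"])
        show "gpath h' (u # P)"
          using grows_gpath[OF a(2) P(1)] a by (auto simp: gpath_Cons green_or_forced_iff green_sym)
        show "nbrs_in h' (hd (u # P)) (set (u # P) - {last (u # P)})"
          using a(3) mem ne by (auto simp: nbrs_in_def)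
        show "bank h' K"
          using bank_grows[OF K a(2)] dis mem by auto
        show "3 * (D - 1) + 5 + joint K + 2 * (cost h' (u # P) + cost h' K) \<le> 2 * (n - 1)"
          using D(1,3) False grows_cost[OF a(2), of K] grows_cost[OF a(2), of P] a(4) ne
          by (auto simp: cost_Cons green_sym split: if_splits)
      qed (use False D P a dis ne grows_hit[OF a(2)] in auto)
      then show "win l (n - 1) h'"
        using D by (intro IH0) auto
    next
      fix h' u x
      assume a: "u \<notin> ?S" "grows h h' (hd P) ?S" "nbrs_in h' u {hd P}" "x \<noteq> Green" "\<not> hit h x (hd P)"
        "hit h' x (hd P)" "hit h' x u"
      have "x = other b"
        using eq_other a(4,5) P(3,4) by blast
      then have "full h' (hd P)"
        using full_other[OF P(3), of h' "hd P"] grows_hit[OF a(2) P(4)] a(6) by simp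
      \<comment> \<open>The path is reversed because \<open>u\<close> is adjacent to
        \<open>hd P\<close>, whereas \<open>full_full_plus\<close> wants \<open>c\<close> not
        adjacent to the head.\<close>
      then have "full_full_plus l h' (rev P) K u (n - 1)"
        unfolding full_full_plus_def
      proof (intro conjI exI[of _ D])
        show "gpath h' (rev P)"
          using grows_gpath[OF a(2) P(1)] by auto
        show "bank h' K"
          using bank_grows[OF K a(2)] dis mem by auto
        show "\<not> drawn h' u (hd (rev P))"
          using a(3) mem by (auto simp: nbrs_in_def hd_rev)
        show "3 * D + 2 + joint K + 2 * (cost h' (rev P) + cost h' K) \<le> 2 * (n - 1)"
          using D(1,3) False grows_cost[OF a(2), of K] grows_cost[OF a(2), of P]
          by (auto split: if_splits)
      qed (use False D P a dis ne grows_hit[OF a(2)] in \<open>auto simp: hd_rev last_rev\<close>)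
      then show "win l (n - 1) h'"
        using D by (intro IH) auto
    qed (use D mem in auto)
  qed
qed

text \<open>A refusal at the free end gives this end and the fresh vertex the same colour, as
  \<open>half_full_plus\<close> demands.\<close>

lemma free_full_win:
  assumes IH: "\<And>m h P K c. m < n \<Longrightarrow> half_full_plus l h P K c m \<Longrightarrow> win l m h"
    and IH0: "\<And>m h P K. m < n \<Longrightarrow> free_full l h P K m \<Longrightarrow> win l m h"
    and st: "free_full l h P K n"
  shows "win l n h"
proof -
  from st obtain D where P: "gpath h P" "3 \<le> length P" "nbrs_in h (hd P) (set P - {last P})" "full h (last P)"
    and K: "bank h K" and dis: "set P \<inter> set K = {}"
    and D: "length P + length K + D = l" "3 * D + 5 + joint K + 2 * (cost h P + cost h K) \<le> 2 * n"
    by (auto simp: free_full_def)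
  have ne: "P \<noteq> []"
    using P(2) by auto
  then have mem: "hd P \<in> set P" "last P \<in> set P" "hd P \<noteq> last P"
    using hd_neq_last[OF P(1)] P(2) by auto
  show ?thesis
  proof (cases "D = 0")
    case True
    let ?X = "P @ rev K"
    note m = merge[OF P(1) ne P(4) K dis]
    have "last ?X \<notin> set P - {last P}"
    proof (cases "K = []")
      case False
      then have "last ?X = hd K" "hd K \<in> set K"
        by (simp_all add: last_rev)
      then show ?thesis
        using dis by auto
    qed simp
    moreover from this have "last ?X \<noteq> hd P"
      using mem by auto
    ultimately have "green_or_forced h (last ?X) (hd ?X)"
      using nbrs_in_not_drawn[OF P(3)] m(2) ne by (simp add: green_or_forced_iff)
    then show ?thesis
      using True D m P(2) by (intro close_cycle[of h ?X]) (auto split: if_splits)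
  next
    case False
    let ?S = "set P \<union> set K"
    show ?thesis
    proof (rule sprout[of n ?S "hd P" h])
      fix h' u
      assume a: "u \<notin> ?S" "grows h h' (hd P) ?S" "nbrs_in h' u {hd P}" "green h' (hd P) u"
      have "free_full l h' (u # P) K (n - 1)"
        unfolding free_full_def
      proof (intro conjI exI[of _ "D - 1"])
        show "gpath h' (u # P)"
          using grows_gpath[OF a(2) P(1)] a by (auto simp: gpath_Cons green_or_forced_iff green_sym)
        show "nbrs_in h' (hd (u # P)) (set (u # P) - {last (u # P)})"
          using a(3) mem ne by (auto simp: nbrs_in_def)
        show "bank h' K"
          using bank_grows[OF K a(2)] dis mem by auto
        show "3 * (D - 1) + 5 + joint K + 2 * (cost h' (u # P) + cost h' K) \<le> 2 * (n - 1)"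
          using D(2) False grows_cost[OF a(2), of K] grows_cost[OF a(2), of P] a(4) ne
          by (auto simp: cost_Cons green_sym split: if_splits)
      qed (use False D P a dis ne grows_hit[OF a(2)] in auto)
      then show "win l (n - 1) h'"
        using D by (intro IH0) auto
    next
      fix h' u x
      assume a: "u \<notin> ?S" "grows h h' (hd P) ?S" "nbrs_in h' u {hd P}" "x \<noteq> Green" "\<not> hit h x (hd P)"
        "hit h' x (hd P)" "hit h' x u"
      have hdK: "hd K \<in> set K" if "K \<noteq> []"
        using that by simp
      have "half_full_plus l h' P K u (n - 1)"
        unfolding half_full_plus_def
      proof (intro conjI exI[of _ D] impI)
        show "gpath h' P"
          using grows_gpath[OF a(2) P(1)] by auto
        show "bank h' K"
          using bank_grows[OF K a(2)] dis mem by auto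
        show "\<exists>b. b \<noteq> Green \<and> hit h' b (hd P) \<and> hit h' b u"
          using a by blast
        show "3 * D + 3 + joint K + 2 * (cost h' P + cost h' K) \<le> 2 * (n - 1)"
          using D(2) False grows_cost[OF a(2), of K] grows_cost[OF a(2), of P]
          by (auto split: if_splits)
        assume "K \<noteq> []"
        then have "hd K \<in> set K" "hd K \<notin> set P"
          using hdK dis by auto
        then have "\<not> drawn h (hd P) (hd K)"
          using P(3) by (auto simp: nbrs_in_def)
        then have "\<not> drawn h' (hd P) (hd K)"
          using grows_drawn[OF a(2), of "hd P" "hd K"] mem \<open>hd K \<in> set K\<close> by auto
        then show "\<not> drawn h' (hd P) u \<or> \<not> drawn h' (hd P) (hd K)"
          by blast
        show "\<not> drawn h' u (hd K)"
          using a(3) \<open>hd K \<notin> set P\<close> mem by (auto simp: nbrs_in_def)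
      qed (use False D P a dis ne grows_hit[OF a(2)] in auto)
      then show "win l (n - 1) h'"
        using D by (intro IH) auto
    qed (use D mem in auto)
  qed
qed

text \<open>The only place where the bank is indispensable: the half end and \<open>c\<close> may be adjacent.\<close>

lemma half_full_plus_last_two:
  assumes P: "gpath h P" "2 \<le> length P" "b \<noteq> Green" "hit h b (hd P)" "hit h b c" "full h (last P)"
    and K: "bank h K" "K \<noteq> []" and dis: "set P \<inter> set K = {}" "c \<notin> set P" "c \<notin> set K"
    and nd: "\<not> drawn h (hd P) c \<or> \<not> drawn h (hd P) (hd K)" "\<not> drawn h c (hd K)"
    and n: "length P + length K + 2 = l" "cost h P + cost h K + 5 \<le> n"
  shows "win l n h"
proof -
  let ?S = "insert c (set P \<union> set K)"
  have ne: "P \<noteq> []"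
    using P(2) by auto
  then have mem: "hd P \<in> set P" "last P \<in> set P" "hd P \<noteq> last P" "hd K \<in> set K" "last K \<in> set K"
    using hd_neq_last[OF P(1,2)] K by auto
  then have neq: "hd P \<noteq> hd K" "hd P \<noteq> last K" "c \<noteq> hd P" "c \<noteq> last P" "c \<noteq> hd K" "c \<noteq> last K"
    "last P \<noteq> last K"
    using dis by auto
  have l: "3 \<le> l"
    using n P(2) by auto
  show ?thesis
  proof (rule sprout[of n ?S c h])
    fix h' y x
    assume a: "y \<notin> ?S" "grows h h' c ?S" "nbrs_in h' y {c}" "x \<noteq> Green" "\<not> hit h x c" "hit h' x c" "hit h' x y"
    have "x = other b"
      using eq_other a(4,5) P(3,5) by blast
    then have cF: "full h' c"
      using full_other[OF P(3), of h' c] grows_hit[OF a(2) P(5)] a(6) by simp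
    obtain s where s: "s \<notin> ?S" "\<And>y. \<not> drawn h' s y" "\<And>y. \<not> drawn h' y s"
      by (rule ex_fresh[of ?S h']) auto
    have P': "gpath h' P" and K': "bank h' K" and F: "full h' (last P)" "full h' (hd K)"
      using grows_gpath[OF a(2) P(1)] bank_grows[OF K(1) a(2)] grows_hit[OF a(2)] P(6) K dis
      by (auto simp: bank_def)
    have cl: "cost h' P \<le> cost h P" "cost h' K \<le> cost h K"
      using grows_cost[OF a(2)] by auto
    have sn: "s \<noteq> c" "s \<noteq> last P" "s \<noteq> hd K"
      using s(1) mem by auto
    show "win l (n - 1) h'"
    proof (cases "drawn h (hd P) c")
      case False
      note m = merge[OF P' ne F(1) K' dis(1)]
      have "green_or_forced h' c (hd P)"
        using cF False grows_drawn[OF a(2), of "hd P" c] mem(1) neq by (auto simp: green_or_forced_iff drawn_sym)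
      moreover have "gpath h' ((P @ rev K) @ [s, c])"
        using m s sn K(2) dis F cF by (subst gpath_append) (auto simp: gpath_Cons green_or_forced_iff last_rev)
      ultimately show ?thesis
        using m(3) cl n l cost_append_le[of h' "P @ rev K" "[s, c]"] ne K(2)
        by (intro close_cycle[of h' "(P @ rev K) @ [s, c]"]) (auto split: if_splits)
    next
      \<comment> \<open>The edge from \<open>c\<close> to \<open>hd P\<close> is spent, so
        \<open>c\<close> is placed between \<open>P\<close> and the bank, and the full head of the
        bank closes the cycle.\<close>
      case True
      then have "\<not> drawn h (hd P) (hd K)"
        using nd(1) by blast
      then have "green_or_forced h' (hd K) (hd P)"
        using F grows_drawn[OF a(2), of "hd P" "hd K"] mem neq by (auto simp: green_or_forced_iff drawn_sym)
      moreover have "gpath h' (P @ [s, c] @ rev K)"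
        using P' bank_gpath[OF K'] s sn K(2) dis F cF ne last_bank_undrawn[OF K' K(2), of c] neq
        by (auto simp: gpath_append gpath_Cons green_or_forced_iff hd_rev)
      ultimately show ?thesis
        using cl n l cost_append_le[of h' "[s, c]" "rev K"] cost_append_le[of h' P "[s, c] @ rev K"] ne K(2)
        by (intro close_cycle[of h' "P @ [s, c] @ rev K"]) (auto simp: last_rev split: if_splits)
    qed
  next
    fix h' y
    assume a: "y \<notin> ?S" "grows h h' c ?S" "nbrs_in h' y {c}" "green h' c y"
    have P': "gpath h' P" and K': "bank h' K" and F: "full h' (last P)" "full h' (hd K)"
      using grows_gpath[OF a(2) P(1)] bank_grows[OF K(1) a(2)] grows_hit[OF a(2)] P(6) K dis
      by (auto simp: bank_def)
    have cl: "cost h' P \<le> cost h P" "cost h' K \<le> cost h K"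
      using grows_cost[OF a(2)] by auto
    have yn: "y \<noteq> c" "y \<noteq> last P" "y \<noteq> hd K" "y \<noteq> hd P" "y \<notin> set P" "y \<notin> set K" "y \<noteq> last K"
      using a(1) mem by auto
    have ynd: "\<not> drawn h' y v \<and> \<not> drawn h' v y" if "v \<noteq> c" for v
      using a(3) that by (auto simp: nbrs_in_def drawn_sym)
    have cnd: "\<not> drawn h' c (hd K)"
      using grows_drawn[OF a(2), of c "hd K"] nd(2) mem by auto
    show "win l (n - 1) h'"
    proof (rule step_pred[of "n - 1" y "hd P"])
      let ?h = "draw h' y (hd P) Green"
      have K'': "bank ?h K" "gpath ?h P" "full ?h (last P)" "full ?h (hd K)"
        using K' F yn mem neq gpath_draw P' dis by (auto simp: bank_def hit_draw intro!: gpath_draw nbrs_in_draw)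
      note m = merge[OF K''(2) ne K''(3) K''(1) dis(1)]
      have "gpath ?h ((P @ rev K) @ [c, y])"
        using m yn K(2) dis K''(4) a(4) cnd neq
        by (subst gpath_append) (auto simp: gpath_Cons green_or_forced_iff last_rev drawn_sym)
      moreover have "cost ?h [c, y] = 0" "cost ?h P \<le> cost h' P" "cost ?h K \<le> cost h' K"
        using a(4) by (auto intro: cost_ext_le)
      ultimately show "win l (n - 1 - 1) ?h"
        using m(3) cl n l cost_append_le[of ?h "P @ rev K" "[c, y]"] ne K(2)
        by (intro close_cycle_green[of ?h "(P @ rev K) @ [c, y]"]) (auto split: if_splits)
    next
      fix x
      assume x: "x \<noteq> Green" "\<not> hit h' x y" "\<not> hit h' x (hd P)"
      let ?h = "draw h' y (hd P) x"
      have "x = other b"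
        using eq_other x(1,3) P(3) grows_hit[OF a(2) P(4)] by blast
      then have half_full: "full ?h (hd P)"
        using full_other[OF P(3), of ?h "hd P"] grows_hit[OF a(2) P(4)] yn by (simp add: hit_draw)
      have Q: "gpath ?h P" "gpath ?h K" "full ?h (last P)" "full ?h (hd K)"
        using P' bank_gpath[OF K'] yn F mem neq by (auto simp: hit_draw intro: gpath_draw)
      \<comment> \<open>The bank is traversed forwards: the refusal has made \<open>hd P\<close>
        full, so the closing edge may go to the free end of the bank.\<close>
      have "gpath ?h (P @ [y, c] @ K)"
        using Q yn dis a(4) cnd neq ynd ne K(2) mem
        by (auto simp: gpath_append gpath_Cons green_or_forced_iff green_sym[of _ y c])
      moreover have "green_or_forced ?h (last K) (hd P)"
        using half_full last_bank_undrawn[OF K' K(2), of "hd P"] neq yn mem dis by (auto simp: green_or_forced_iff)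
      moreover have "cost ?h [y, c] = 0" "cost ?h P \<le> cost h' P" "cost ?h K \<le> cost h' K"
        using a(4) by (auto intro: cost_ext_le simp: green_sym)
      ultimately show "win l (n - 1 - 1) ?h"
        using cl n l cost_append_le[of ?h "[y, c]" K] cost_append_le[of ?h P "[y, c] @ K"] ne K(2)
        by (intro close_cycle[of ?h "P @ [y, c] @ K"]) (auto split: if_splits)
    next
      show "0 < n - 1"
        using n(2) by linarith
    qed (use yn ynd neq in auto)
  qed (use n in auto)
qed

text \<open>If \<open>c\<close> becomes full, the next half vertex has the colour opposite to that
  of the half end, so their edge is forced: one coloured edge then brings three vertices,
  \<open>D - 3 \<le> 2(r - 1) - 1\<close>. If both edges at \<open>c\<close> are green,
  \<open>u\<close> is tried at \<open>hd P\<close>; after a refusal \<open>hd P\<close> is full and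
  the three vertices are hooked on by \<open>y\<close> instead, with \<open>u\<close> as half
  end.\<close>

lemma half_full_plus_win:
  assumes IH: "\<And>m h P K. m < n \<Longrightarrow> half_full l h P K m \<Longrightarrow> win l m h"
    and IH0: "\<And>m h P K. m < n \<Longrightarrow> free_full l h P K m \<Longrightarrow> win l m h"
    and now: "\<And>P K. half_full l h P K n \<Longrightarrow> win l n h"
    and st: "half_full_plus l h P K c n"
  shows "win l n h"
proof -
  from st obtain b D where P: "gpath h P" "2 \<le> length P" "b \<noteq> Green" "hit h b (hd P)" "hit h b c" "full h (last P)"
    and K: "bank h K" and dis: "set P \<inter> set K = {}" "c \<notin> set P" "c \<notin> set K"
    and D: "1 \<le> D" "length P + length K + D = l" "3 * D + 3 + joint K + 2 * (cost h P + cost h K) \<le> 2 * n"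
    and nd: "D = 2 \<longrightarrow> K \<noteq> [] \<longrightarrow> (\<not> drawn h (hd P) c \<or> \<not> drawn h (hd P) (hd K)) \<and> \<not> drawn h c (hd K)"
    by (auto simp: half_full_plus_def)
  have ne: "P \<noteq> []"
    using P(2) by auto
  then have mem: "hd P \<in> set P" "last P \<in> set P" "hd P \<noteq> last P" "c \<noteq> hd P"
    using hd_neq_last[OF P(1,2)] dis(2) by auto
  consider "D = 1" | "D = 2" "K = [] \<or> cost h P + cost h K + 6 \<le> n" | "D = 2" "K \<noteq> []" | "3 \<le> D"
    using D(1) by linarith
  then show ?thesis
  proof cases
    case 1
    then show ?thesis
      using P K dis D by (intro close_half_full[of h P b K]) (auto split: if_splits)
  next
    case 2
    \<comment> \<open>The bound of \<open>half_full\<close> asks for one unit more. Without a bank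
      it comes from rounding, as an odd number is at most the even \<open>2 * n\<close>.\<close>
    then have "half_full l h P K n"
      unfolding half_full_def using P K dis D by (intro conjI exI[of _ D]) (auto split: if_splits, presburger)
    then show ?thesis
      by (rule now)
  next
    case 3
    then show ?thesis
      using half_full_plus_last_two[OF P K _ dis] nd D by (auto split: if_splits)
  next
    case 4
    let ?S = "insert c (set P \<union> set K)"
    show ?thesis
    proof (rule probe[of n ?S c h b])
      fix h' z e m
      assume a: "z \<notin> ?S" "e \<notin> ?S" "z \<noteq> e" "grows h h' c ?S" "full h' c" "green_or_forced h' c z" "nbrs_in h' z {c}"
        "nbrs_in h' e {c}" "hit h' (other b) e" "m + 2 = n + cost h' [c, z]"
      have "bank h' K"
        using bank_grows[OF K a(4)] dis by auto
      note K' = bank_snoc[OF this a(5) dis(3) _ _ a(6,7)]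
      have P': "gpath h' P" "full h' (last P)" "hit h' b (hd P)"
        using grows_gpath[OF a(4) P(1)] grows_hit[OF a(4)] P by auto
      have cl: "cost h' P \<le> cost h P" "cost h' K \<le> cost h K"
        using grows_cost[OF a(4)] by auto
      show "win l m h'"
      proof (cases "D = 3")
        case True
        then show ?thesis
          using P(2,3) P' K' dis a(1,2,10) D cl
          by (intro close_half_full[of h' P b "K @ [c, z]"]) (auto split: if_splits)
      next
        case False
        have "e \<noteq> hd P"
          using a(2) mem by auto
        then have "green_or_forced h' (hd P) e"
          using P'(3) a(8,9) mem P(3) by (intro forced_if_other[of h' b]) (auto simp: nbrs_in_def drawn_sym)
        then have "gpath h' (e # P)"
          using P'(1) a(2) by (auto simp: gpath_Cons green_or_forced_sym)
        moreover have "cost h' (e # P) \<le> cost h P + 1"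
          using cl ne by (auto simp: cost_Cons)
        ultimately have "half_full l h' (e # P) (K @ [c, z]) m"
          unfolding half_full_def using P P' K' dis a(1,2,3,9,10) D cl False 4 ne
          by (intro conjI exI[of _ "D - 3"] exI[of _ "other b"]) (auto split: if_splits)
        then show ?thesis
          using a(10) by (intro IH) (auto split: if_splits)
      qed
    next
      fix h' u y
      assume a: "u \<notin> ?S" "y \<notin> ?S" "u \<noteq> y" "grows h h' c ?S" "green h' c y" "green h' c u"
        "nbrs_in h' u {c}" "nbrs_in h' y {c}"
      have P': "gpath h' P" "full h' (last P)" "hit h' b (hd P)" "bank h' K"
        using grows_gpath[OF a(4) P(1)] grows_hit[OF a(4)] P bank_grows[OF K a(4)] dis by auto
      have cl: "cost h' P \<le> cost h P" "cost h' K \<le> cost h K"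
        using grows_cost[OF a(4)] by auto
      have uh: "u \<noteq> hd P" "\<not> drawn h' u (hd P)" "y \<noteq> hd P"
        using a mem by (auto simp: nbrs_in_def)
      have "u \<notin> set K" "hd P \<notin> set K"
        using a(1) dis(1) mem(1) by auto
      then have lastK: "last K \<noteq> u" "last K \<noteq> hd P" if "K \<noteq> []"
        using last_in_set[OF that] by metis+
      have P'': "gpath (draw h' u (hd P) x) P" "full (draw h' u (hd P) x) (last P)" "bank (draw h' u (hd P) x) K"
        "cost (draw h' u (hd P) x) P \<le> cost h P" "cost (draw h' u (hd P) x) K \<le> cost h K" for x
        using P' uh a(1) lastK cl cost_ext_le[of h' u "hd P" x P] cost_ext_le[of h' u "hd P" x K]
        by (auto simp: hit_draw bank_def intro!: gpath_draw nbrs_in_draw)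
      show "win l (n - 2) h'"
      proof (rule step_pred[of "n - 2" u "hd P"])
        let ?h = "draw h' u (hd P) Green"
        have "free_full l ?h (y # c # u # P) K (n - 2 - 1)"
          unfolding free_full_def
        proof (intro conjI exI[of _ "D - 3"])
          show "gpath ?h (y # c # u # P)"
            using P''(1)[of Green] a uh dis by (auto simp: gpath_Cons green_or_forced_iff green_sym)
          show "nbrs_in ?h (hd (y # c # u # P)) (set (y # c # u # P) - {last (y # c # u # P)})"
            using a(3,8) uh mem dis ne by (auto simp: nbrs_in_def)
          show "3 * (D - 3) + 5 + joint K + 2 * (cost ?h (y # c # u # P) + cost ?h K) \<le> 2 * (n - 2 - 1)"
            using D(3) 4 P''(4,5)[of Green] a ne by (auto simp: cost_Cons green_sym split: if_splits)
        qed (use D 4 P'' a dis ne in auto)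
        then show "win l (n - 2 - 1) ?h"
          using D 4 by (intro IH0) auto
      next
        fix x
        assume x: "x \<noteq> Green" "\<not> hit h' x u" "\<not> hit h' x (hd P)"
        let ?h = "draw h' u (hd P) x"
        have "x = other b"
          using eq_other x(1,3) P(3) P'(3) by blast
        then have hdF: "full ?h (hd P)"
          using full_other[OF P(3), of ?h "hd P"] P'(3) uh by (simp add: hit_draw)
        have ux: "hit ?h x u"
          using uh by (simp add: hit_draw)
        have yP: "green_or_forced ?h y (hd P)"
          using hdF uh a(3,8) mem(4) by (auto simp: green_or_forced_iff nbrs_in_def)
        have FPu: "gpath ?h (u # c # y # P)"
          using P''(1)[of x] a uh dis yP by (auto simp: gpath_Cons green_or_forced_iff green_sym)
        have cu: "cost ?h (u # c # y # P) \<le> cost h P + 1"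
          using P''(4)[of x] a ne by (auto simp: cost_Cons green_sym)
        show "win l (n - 2 - 1) ?h"
        proof (cases "D = 3")
          case True
          let ?X = "(u # c # y # P) @ rev K"
          have dis': "set (u # c # y # P) \<inter> set K = {}"
            using dis a by auto
          have m: "gpath ?h ?X" "full ?h (last ?X)" "cost ?h ?X \<le> cost ?h (u # c # y # P) + cost ?h K + joint K"
            using merge[OF FPu _ _ P''(3) dis'] P''(2) ne by auto
          have "last ?X \<notin> {u, c, hd P}"
          proof (cases "K = []")
            case True
            then show ?thesis
              using mem dis ne a(1) by auto
          next
            case False
            then have "last ?X = hd K" "hd K \<in> set K"
              by (simp_all add: last_rev)
            then show ?thesis
              using dis a(1) mem by auto
          qed
          then have "green_or_forced ?h (last ?X) (hd ?X)"
            using m(2) a(7) uh by (auto simp: green_or_forced_iff nbrs_in_def drawn_sym)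
          moreover have "cost ?h ?X + 1 \<le> n - 2 - 1"
          proof -
            define cX cU where "cX = cost ?h ?X" and "cU = cost ?h (u # c # y # P)"
            have "cX \<le> cU + cost ?h K + joint K" "cU \<le> cost h P + 1"
              using m(3) cu by (simp_all only: cX_def cU_def)
            then have "cX + 1 \<le> n - 2 - 1"
              using P''(5)[of x] D(3) True by (auto split: if_splits)
            then show ?thesis
              by (simp only: cX_def)
          qed
          ultimately show ?thesis
            using m(1) True D(2) P(2) by (intro close_cycle[of ?h ?X]) (auto simp del: cost.simps)
        next
          case False
          have "half_full l ?h (u # c # y # P) K (n - 2 - 1)"
            unfolding half_full_def
          proof (intro conjI exI[of _ "D - 3"])
            show "\<exists>b. b \<noteq> Green \<and> hit ?h b (hd (u # c # y # P))"
              using x(1) ux by auto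
            show "3 * (D - 3) + 4 + joint K + 2 * (cost ?h (u # c # y # P) + cost ?h K) \<le> 2 * (n - 2 - 1)"
              using D(3) 4 cu P''(5)[of x] by (auto split: if_splits)
          qed (use D 4 False FPu P'' a dis ne in auto)
          then show ?thesis
            using D 4 by (intro IH) auto
        qed
      qed (use D 4 uh in auto)
    qed (use D 4 P in auto)
  qed
qed

text \<open>A simultaneous induction on the rounds left. Only \<open>half_full_plus\<close> may turn
  into \<open>half_full\<close> without a move, so \<open>half_full\<close> is settled first at each
  \<open>n\<close>.\<close>

lemma full_end_win:
  shows "full_full_plus l h P K c n \<Longrightarrow> win l n h" "half_full l h P K n \<Longrightarrow> win l n h"
    "free_full l h P K n \<Longrightarrow> win l n h" "half_full_plus l h P K c n \<Longrightarrow> win l n h"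
proof -
  have "(\<forall>P K c. full_full_plus l h P K c n \<longrightarrow> win l n h) \<and> (\<forall>P K. half_full l h P K n \<longrightarrow> win l n h) \<and>
      (\<forall>P K. free_full l h P K n \<longrightarrow> win l n h) \<and> (\<forall>P K c. half_full_plus l h P K c n \<longrightarrow> win l n h)" for h
  proof (induction n arbitrary: h rule: less_induct)
    case (less n)
    have 1: "win l m h" if "m < n" "full_full_plus l h P K c m" for m h P K c
      using less[OF that(1), of h] that(2) by blast
    have 2: "win l m h" if "m < n" "half_full l h P K m" for m h P K
      using less[OF that(1), of h] that(2) by blast
    have 3: "win l m h" if "m < n" "free_full l h P K m" for m h P K
      using less[OF that(1), of h] that(2) by blast
    have 4: "win l m h" if "m < n" "half_full_plus l h P K c m" for m h P K c
      using less[OF that(1), of h] that(2) by blast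
    have half_full: "win l n h" if "half_full l h P K n" for P K
      using 1 3 that by (rule half_full_win)
    moreover have "win l n h" if "full_full_plus l h P K c n" for P K c
      using 1 3 that by (rule full_full_plus_win)
    moreover have "win l n h" if "free_full l h P K n" for P K
      using 4 3 that by (rule free_full_win)
    moreover have "win l n h" if "half_full_plus l h P K c n" for P K c
      using 2 3 half_full that by (rule half_full_plus_win)
    ultimately show ?case
      by blast
  qed
  then show "full_full_plus l h P K c n \<Longrightarrow> win l n h" "half_full l h P K n \<Longrightarrow> win l n h"
    "free_full l h P K n \<Longrightarrow> win l n h" "half_full_plus l h P K c n \<Longrightarrow> win l n h"
    by blast+
qed

subsection \<open>Detached pieces without a bank\<close>

text \<open>Here \<open>Q\<close> has two full ends and \<open>Z\<close> runs from a free to a half end. Leaving them unlinked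
  lets \<open>Z\<close> become the bank once its half end is full.\<close>

definition detached_half_full :: "nat \<Rightarrow> history \<Rightarrow> nat list \<Rightarrow> nat list \<Rightarrow> nat \<Rightarrow> bool" where
  "detached_half_full l h Q Z n \<longleftrightarrow> gpath h Q \<and> Q \<noteq> [] \<and> full h (hd Q) \<and> full h (last Q) \<and> gpath h Z \<and> 2 \<le> length Z \<and>
     nbrs_in h (hd Z) (set Z) \<and> (\<exists>b. b \<noteq> Green \<and> hit h b (last Z)) \<and> set Q \<inter> set Z = {} \<and>
     (\<exists>D. 5 \<le> D \<and> length Q + length Z + D = l \<and> 3 * D + 5 + 2 * (cost h Q + cost h Z) \<le> 2 * n)"

lemma link_detached:
  assumes "gpath h Q" "Q \<noteq> []" "full h (hd Q)" "gpath h Z" "Z \<noteq> []" "nbrs_in h (hd Z) (set Z)" "set Q \<inter> set Z = {}"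
  shows "gpath h (rev Z @ Q)" "cost h (rev Z @ Q) \<le> cost h Z + cost h Q + 1"
proof -
  have "hd Q \<notin> set Z" "hd Z \<in> set Z"
    using assms(2,5,7) hd_in_set by fastforce+
  then have "hd Z \<noteq> hd Q" "\<not> drawn h (hd Z) (hd Q)"
    using assms(6) by (auto simp: nbrs_in_def)
  then show "gpath h (rev Z @ Q)"
    using assms by (auto simp: gpath_append last_rev green_or_forced_iff)
  show "cost h (rev Z @ Q) \<le> cost h Z + cost h Q + 1"
    using cost_append_le[of h "rev Z" Q] by simp
qed

text \<open>The bound \<open>D \<le> 2r\<close> is that of \<open>half_full_plus\<close> with a
  bank, although there is none. Painter's answers decide the role of \<open>Z\<close>: it is linked
  to \<open>Q\<close> by its free end, or its half end becomes full and \<open>rev Z\<close> is a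
  bank.\<close>

lemma detached_half_full_plus_win:
  assumes Q: "gpath h Q" "Q \<noteq> []" "full h (hd Q)" "full h (last Q)"
    and Z: "gpath h Z" "2 \<le> length Z" "nbrs_in h (hd Z) (set Z)" "b \<noteq> Green" "hit h b (last Z)" "hit h b c"
    and dis: "set Q \<inter> set Z = {}" "c \<notin> set Q" "c \<notin> set Z"
    and D: "4 \<le> D" "length Q + length Z + D = l" "3 * D + 4 + 2 * (cost h Q + cost h Z) \<le> 2 * n"
  shows "win l n h"
proof -
  have ne: "Z \<noteq> []"
    using Z(2) by auto
  then have mem: "hd Z \<in> set Z" "last Z \<in> set Z" "hd Z \<noteq> last Z" "hd Q \<in> set Q" "last Q \<in> set Q"
    using hd_neq_last[OF Z(1,2)] Q(2) by auto
  then have neq: "c \<noteq> hd Z" "c \<noteq> last Z" "c \<noteq> hd Q" "c \<noteq> last Q" "hd Q \<noteq> last Z" "last Q \<noteq> last Z"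
    using dis by auto
  let ?S = "insert c (set Q \<union> set Z)"
  show ?thesis
  proof (rule probe[of n ?S c h b])
    fix h' z e m
    assume a: "z \<notin> ?S" "e \<notin> ?S" "z \<noteq> e" "grows h h' c ?S" "full h' c" "green_or_forced h' c z" "nbrs_in h' z {c}"
      "nbrs_in h' e {c}" "hit h' (other b) e" "m + 2 = n + cost h' [c, z]"
    have bk: "bank h' [c, z]"
      using bank_snoc(1)[of h' "[]" c z] a by auto
    have Q': "gpath h' Q" "full h' (hd Q)" "full h' (last Q)"
      using grows_gpath[OF a(4)] grows_hit[OF a(4)] Q by auto
    have Z': "gpath h' Z" "nbrs_in h' (hd Z) (set Z)" "hit h' b (last Z)"
      using grows_gpath[OF a(4)] grows_hit[OF a(4)] grows_nbrs_in[OF a(4)] Z mem neq by auto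
    have cl: "cost h' Q \<le> cost h Q" "cost h' Z \<le> cost h Z"
      using grows_cost[OF a(4)] by auto
    note L = link_detached[OF Q'(1) Q(2) Q'(2) Z'(1) ne Z'(2) dis(1)]
    have "e \<noteq> last Z"
      using a(2) mem by auto
    then have "green_or_forced h' (last Z) e"
      using Z'(3) a(8,9) neq Z(4) by (intro forced_if_other[of h' b]) (auto simp: nbrs_in_def drawn_sym)
    then have "gpath h' (e # rev Z @ Q)"
      using L(1) a(2) ne by (auto simp: gpath_Cons green_or_forced_sym hd_rev)
    moreover have "cost h' (e # rev Z @ Q) \<le> cost h Q + cost h Z + 2"
      using L(2) cl ne by (auto simp: cost_Cons)
    moreover have "length (e # rev Z @ Q) + length [c, z] + (D - 3) = l" "1 \<le> D - 3" "2 \<le> length (e # rev Z @ Q)"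
      using D Z(2) by simp_all
    moreover have "3 * (D - 3) + 4 + joint [c, z] + 2 * (cost h' (e # rev Z @ Q) + cost h' [c, z]) \<le> 2 * m"
      using calculation(2) a(10) D by (simp del: cost.simps(1))
    moreover have "set (e # rev Z @ Q) \<inter> set [c, z] = {}"
      using dis a(1-3) by auto
    ultimately have "half_full l h' (e # rev Z @ Q) [c, z] m"
      unfolding half_full_def using bk Q'(3) Q(2) Z(4) a(9)
      by (intro conjI exI[of _ "D - 3"] exI[of _ "other b"]) (simp_all del: cost.simps(1))
    then show "win l m h'"
      by (rule full_end_win)
  next
    fix h' u y
    assume a: "u \<notin> ?S" "y \<notin> ?S" "u \<noteq> y" "grows h h' c ?S" "green h' c y" "green h' c u"
      "nbrs_in h' u {c}" "nbrs_in h' y {c}"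
    have Q': "gpath h' Q" "full h' (hd Q)" "full h' (last Q)"
      using grows_gpath[OF a(4)] grows_hit[OF a(4)] Q by auto
    have Z': "gpath h' Z" "nbrs_in h' (hd Z) (set Z)" "hit h' b (last Z)"
      using grows_gpath[OF a(4)] grows_hit[OF a(4)] grows_nbrs_in[OF a(4)] Z mem neq by auto
    have cl: "cost h' Q \<le> cost h Q" "cost h' Z \<le> cost h Z"
      using grows_cost[OF a(4)] by auto
    have un: "u \<noteq> last Z" "u \<noteq> hd Z" "u \<noteq> hd Q" "u \<noteq> last Q" "y \<noteq> last Z" "y \<noteq> hd Z" "y \<noteq> hd Q" "y \<noteq> last Q"
      "u \<noteq> c" "y \<noteq> c" "u \<notin> set Z" "u \<notin> set Q" "y \<notin> set Z" "y \<notin> set Q"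
      using a(1,2) mem by auto
    have X: "gpath (draw h' u (last Z) x) Q" "full (draw h' u (last Z) x) (hd Q)" "full (draw h' u (last Z) x) (last Q)"
      "gpath (draw h' u (last Z) x) Z" "nbrs_in (draw h' u (last Z) x) (hd Z) (set Z)"
      "cost (draw h' u (last Z) x) Q \<le> cost h Q" "cost (draw h' u (last Z) x) Z \<le> cost h Z" for x
      using Q' Z' un mem cl cost_ext_le[of h' u "last Z" x Q] cost_ext_le[of h' u "last Z" x Z]
      by (auto simp: hit_draw intro!: gpath_draw nbrs_in_draw)
    show "win l (n - 2) h'"
    proof (rule step_pred[of "n - 2" u "last Z"])
      let ?h = "draw h' u (last Z) Green"
      note L = link_detached[OF X(1) Q(2) X(2,4) ne X(5) dis(1)]
      have "gpath ?h (y # c # u # rev Z @ Q)"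
        using L(1)[of Green] a(3,5,6) un dis ne by (auto simp: gpath_Cons green_or_forced_iff green_sym hd_rev)
      moreover have "cost ?h (y # c # u # rev Z @ Q) \<le> cost h Q + cost h Z + 1"
        using L(2)[of Green] X(6,7)[of Green] a(5,6) ne by (auto simp: cost_Cons green_sym hd_rev)
      moreover have "nbrs_in ?h y (set (y # c # u # rev Z @ Q) - {last (y # c # u # rev Z @ Q)})"
        by (rule nbrs_in_mono[OF nbrs_in_draw[OF a(8)]]) (use a(3) un neq Q(2) in auto)
      moreover have "length (y # c # u # rev Z @ Q) + length [] + (D - 3) = l" "3 \<le> length (y # c # u # rev Z @ Q)"
        using D by simp_all
      moreover have "3 * (D - 3) + 5 + joint [] + 2 * (cost ?h (y # c # u # rev Z @ Q) + cost ?h []) \<le> 2 * (n - 2 - 1)"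
        using calculation(2) D by (simp del: cost.simps(1))
      ultimately have "free_full l ?h (y # c # u # rev Z @ Q) [] (n - 2 - 1)"
        unfolding free_full_def using X(3)[of Green] Q(2)
        by (intro conjI exI[of _ "D - 3"]) (simp_all del: cost.simps(1))
      then show "win l (n - 2 - 1) ?h"
        by (rule full_end_win)
    next
      fix x
      assume x: "x \<noteq> Green" "\<not> hit h' x u" "\<not> hit h' x (last Z)"
      let ?h = "draw h' u (last Z) x"
      have "x = other b"
        using eq_other x(1,3) Z(4) Z'(3) by blast
      then have hdF: "full ?h (last Z)"
        using full_other[OF Z(4), of ?h "last Z"] Z'(3) un by (simp add: hit_draw)
      have "green_or_forced ?h y (hd Q)"
        using X(2)[of x] un neq a(3,8) by (auto simp: green_or_forced_iff nbrs_in_def)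
      then have "gpath ?h (u # c # y # Q)"
        using X(1)[of x] a(3,5,6) un dis by (auto simp: gpath_Cons green_or_forced_iff green_sym)
      moreover have "cost ?h (u # c # y # Q) \<le> cost h Q + 1"
        using X(6)[of x] a(5,6) Q(2) by (auto simp: cost_Cons green_sym)
      moreover have "bank ?h (rev Z)"
        using X(4,5)[of x] hdF ne by (auto simp: bank_def hd_rev last_rev)
      moreover have "hit ?h x u"
        using un by (simp add: hit_draw)
      moreover have "length (u # c # y # Q) + length (rev Z) + (D - 3) = l" "1 \<le> D - 3"
        using D by simp_all
      moreover have "3 * (D - 3) + 4 + joint (rev Z) + 2 * (cost ?h (u # c # y # Q) + cost ?h (rev Z)) \<le> 2 * (n - 2 - 1)"
        using calculation(2) X(7)[of x] D ne by (simp del: cost.simps(1))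
      moreover have "set (u # c # y # Q) \<inter> set (rev Z) = {}"
        using dis un by auto
      ultimately have "half_full l ?h (u # c # y # Q) (rev Z) (n - 2 - 1)"
        unfolding half_full_def using X(3)[of x] x(1) Q(2)
        by (intro conjI exI[of _ "D - 3"] exI[of _ x]) (simp_all del: cost.simps(1))
      then show "win l (n - 2 - 1) ?h"
        by (rule full_end_win)
    next
      show "0 < n - 2"
        using D by linarith
    qed (use un(1) a(7) neq in \<open>auto simp: nbrs_in_def\<close>)
  qed (use D Z in auto)
qed

text \<open>Nothing is known about colours at \<open>last Z\<close>. A green answer links the pieces
  and leaves a free end; a refusal supplies the two vertices of equal colour for the preceding
  position.\<close>

lemma detached_free_full_win:
  assumes Q: "gpath h Q" "Q \<noteq> []" "full h (hd Q)" "full h (last Q)"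
    and Z: "gpath h Z" "2 \<le> length Z" "nbrs_in h (hd Z) (set Z)"
    and dis: "set Q \<inter> set Z = {}"
    and D: "4 \<le> D" "length Q + length Z + D = l" "3 * D + 6 + 2 * (cost h Q + cost h Z) \<le> 2 * n"
  shows "win l n h"
proof -
  have ne: "Z \<noteq> []"
    using Z(2) by auto
  then have mem: "hd Z \<in> set Z" "last Z \<in> set Z" "hd Z \<noteq> last Z" "hd Q \<in> set Q" "last Q \<in> set Q"
    using hd_neq_last[OF Z(1,2)] Q(2) by auto
  then have neq: "hd Q \<noteq> last Z" "last Q \<noteq> last Z"
    using dis by auto
  let ?S = "set Q \<union> set Z"
  have X: "gpath h' Q" "full h' (hd Q)" "full h' (last Q)" "gpath h' Z" "nbrs_in h' (hd Z) (set Z)"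
    "cost h' Q \<le> cost h Q" "cost h' Z \<le> cost h Z" if "grows h h' (last Z) ?S" for h'
    using that Q Z mem grows_gpath[OF that] grows_hit[OF that] grows_nbrs_in[OF that] grows_cost[OF that] by auto
  show ?thesis
  proof (rule sprout[of n ?S "last Z" h])
    fix h' u
    assume a: "u \<notin> ?S" "grows h h' (last Z) ?S" "nbrs_in h' u {last Z}" "green h' (last Z) u"
    note X = X[OF a(2)]
    note L = link_detached[OF X(1) Q(2) X(2,4) ne X(5) dis]
    have "gpath h' (u # rev Z @ Q)"
      using L(1) a(1,4) ne by (auto simp: gpath_Cons green_or_forced_iff green_sym hd_rev)
    moreover have "cost h' (u # rev Z @ Q) \<le> cost h Q + cost h Z + 1"
      using L(2) X(6,7) a(4) ne by (auto simp: cost_Cons green_sym hd_rev)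
    moreover have "length (u # rev Z @ Q) + length [] + (D - 1) = l" "3 \<le> length (u # rev Z @ Q)"
      using D Z(2) by simp_all
    moreover have "3 * (D - 1) + 5 + joint [] + 2 * (cost h' (u # rev Z @ Q) + cost h' []) \<le> 2 * (n - 1)"
      using calculation(2) D by (simp del: cost.simps(1))
    moreover have "nbrs_in h' u (set (u # rev Z @ Q) - {last (u # rev Z @ Q)})"
      using a(3) neq mem Q(2) by (auto simp: nbrs_in_def)
    ultimately have "free_full l h' (u # rev Z @ Q) [] (n - 1)"
      unfolding free_full_def using X(3) Q(2)
      by (intro conjI exI[of _ "D - 1"]) (simp_all del: cost.simps(1))
    then show "win l (n - 1) h'"
      by (rule full_end_win)
  next
    fix h' u x
    assume a: "u \<notin> ?S" "grows h h' (last Z) ?S" "nbrs_in h' u {last Z}" "x \<noteq> Green" "\<not> hit h x (last Z)"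
      "hit h' x (last Z)" "hit h' x u"
    note X = X[OF a(2)]
    show "win l (n - 1) h'"
      using detached_half_full_plus_win[OF X(1) Q(2) X(2-4) Z(2) X(5) a(4,6,7) dis, of D l "n - 1"] X(6,7) D a(1) by auto
  qed (use D mem in auto)
qed

lemma detached_half_full_win:
  assumes "detached_half_full l h Q Z n"
  shows "win l n h"
proof -
  from assms obtain b D where Q: "gpath h Q" "Q \<noteq> []" "full h (hd Q)" "full h (last Q)"
    and Z: "gpath h Z" "2 \<le> length Z" "nbrs_in h (hd Z) (set Z)" "b \<noteq> Green" "hit h b (last Z)"
    and dis: "set Q \<inter> set Z = {}"
    and D: "5 \<le> D" "length Q + length Z + D = l" "3 * D + 5 + 2 * (cost h Q + cost h Z) \<le> 2 * n"
    by (auto simp: detached_half_full_def)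
  have ne: "Z \<noteq> []"
    using Z(2) by auto
  then have mem: "hd Z \<in> set Z" "last Z \<in> set Z" "hd Z \<noteq> last Z" "hd Q \<in> set Q" "last Q \<in> set Q"
    using hd_neq_last[OF Z(1,2)] Q(2) by auto
  then have neq: "hd Q \<noteq> last Z"
    using dis by auto
  let ?S = "set Q \<union> set Z"
  have X: "gpath h' Q" "full h' (hd Q)" "full h' (last Q)" "gpath h' Z" "nbrs_in h' (hd Z) (set Z)"
    "cost h' Q \<le> cost h Q" "cost h' Z \<le> cost h Z" if "grows h h' (last Z) ?S" for h'
    using that Q Z mem grows_gpath[OF that] grows_hit[OF that] grows_nbrs_in[OF that] grows_cost[OF that] by auto
  show ?thesis
  proof (rule sprout[of n ?S "last Z" h])
    fix h' u
    assume a: "u \<notin> ?S" "grows h h' (last Z) ?S" "nbrs_in h' u {last Z}" "green h' (last Z) u"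
    note X = X[OF a(2)]
    have "gpath h' (Z @ [u])"
      using X(4) a(1,4) ne by (auto simp: gpath_append gpath_Cons green_or_forced_iff)
    moreover have "cost h' (Z @ [u]) = cost h' Z"
      using a(4) ne by (auto simp: cost_append)
    moreover have "nbrs_in h' (hd (Z @ [u])) (set (Z @ [u]))"
      using X(5) ne by (auto simp: nbrs_in_def)
    ultimately show "win l (n - 1) h'"
      using detached_free_full_win[OF X(1) Q(2) X(2,3), of "Z @ [u]" "D - 1" l "n - 1"] X(6,7) D a(1) dis Z(2) by auto
  next
    fix h' u x
    assume a: "u \<notin> ?S" "grows h h' (last Z) ?S" "nbrs_in h' u {last Z}" "x \<noteq> Green" "\<not> hit h x (last Z)"
      "hit h' x (last Z)" "hit h' x u"
    note X = X[OF a(2)]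
    have "x = other b"
      using eq_other a(4,5) Z(4,5) by blast
    then have "full h' (last Z)"
      using full_other[OF Z(4), of h' "last Z"] grows_hit[OF a(2) Z(5)] a(6) by simp
    then have "bank h' (rev Z)"
      using X(4,5) ne by (auto simp: bank_def hd_rev last_rev)
    then have "full_full_plus l h' Q (rev Z) u (n - 1)"
      unfolding full_full_plus_def using X Q(2) D dis a neq ne
      by (intro conjI exI[of _ D] exI[of _ x]) (auto simp: nbrs_in_def)
    then show "win l (n - 1) h'"
      by (rule full_end_win)
  qed (use D mem in auto)
qed

text \<open>Opposite colours are worth one unit compared with \<open>half_full_plus\<close> without
  a bank: if \<open>c\<close> becomes full, the next half vertex has the colour of
  \<open>hd P\<close>, and there is a bank by then. The bound 8 provides for the three vertices used
  before \<open>detached_half_full\<close>, which asks for 5.\<close>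

lemma opposite_win:
  assumes P: "gpath h P" "2 \<le> length P" "b \<noteq> Green" "hit h b (hd P)" "hit h (other b) c" "full h (last P)"
    and dis: "c \<notin> set P"
    and D: "8 \<le> D" "length P + D = l" "3 * D + 2 + 2 * cost h P \<le> 2 * n"
  shows "win l n h"
proof -
  have ne: "P \<noteq> []"
    using P(2) by auto
  then have mem: "hd P \<in> set P" "last P \<in> set P" "hd P \<noteq> last P"
    using hd_neq_last[OF P(1,2)] by auto
  then have neq: "c \<noteq> hd P" "c \<noteq> last P"
    using dis by auto
  let ?S = "insert c (set P)"
  show ?thesis
  proof (rule probe[of n ?S c h "other b"])
    fix h' z e m
    assume a: "z \<notin> ?S" "e \<notin> ?S" "z \<noteq> e" "grows h h' c ?S" "full h' c" "green_or_forced h' c z" "nbrs_in h' z {c}"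
      "nbrs_in h' e {c}" "hit h' (other (other b)) e" "m + 2 = n + cost h' [c, z]"
    have bk: "bank h' [c, z]"
      using bank_snoc(1)[of h' "[]" c z] a by auto
    have P': "gpath h' P" "full h' (last P)" "hit h' b (hd P)"
      using grows_gpath[OF a(4)] grows_hit[OF a(4)] P by auto
    have "half_full_plus l h' P [c, z] e m"
      unfolding half_full_plus_def using bk P' P(2,3) dis a(1,2,3,9,10) D grows_cost[OF a(4), of P]
      by (intro conjI exI[of _ "D - 2"] exI[of _ b]) auto
    then show "win l m h'"
      by (rule full_end_win)
  next
    fix h' u y
    assume a: "u \<notin> ?S" "y \<notin> ?S" "u \<noteq> y" "grows h h' c ?S" "green h' c y" "green h' c u"
      "nbrs_in h' u {c}" "nbrs_in h' y {c}"
    have P': "gpath h' P" "full h' (last P)" "hit h' b (hd P)"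
      using grows_gpath[OF a(4)] grows_hit[OF a(4)] P by auto
    have un: "u \<noteq> hd P" "u \<noteq> last P" "y \<noteq> hd P" "y \<noteq> last P" "u \<noteq> c" "y \<noteq> c" "u \<notin> set P" "y \<notin> set P"
      using a(1,2) mem by auto
    have X: "gpath (draw h' u (hd P) x) P" "full (draw h' u (hd P) x) (last P)"
      "cost (draw h' u (hd P) x) P \<le> cost h P" for x
      using P' un cost_ext_le[of h' u "hd P" x P] grows_cost[OF a(4), of P]
      by (auto simp: hit_draw intro!: gpath_draw)
    show "win l (n - 2) h'"
    proof (rule step_pred[of "n - 2" u "hd P"])
      let ?h = "draw h' u (hd P) Green"
      have "gpath ?h (y # c # u # P)"
        using X(1)[of Green] a(3,5,6) un dis by (auto simp: gpath_Cons green_or_forced_iff green_sym)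
      moreover have "cost ?h (y # c # u # P) \<le> cost h P"
        using X(3)[of Green] a(5,6) ne by (auto simp: cost_Cons green_sym)
      moreover have "nbrs_in ?h y (set (y # c # u # P) - {last (y # c # u # P)})"
        by (rule nbrs_in_mono[OF nbrs_in_draw[OF a(8)]]) (use a(3) un neq ne in auto)
      moreover have "length (y # c # u # P) + length [] + (D - 3) = l" "3 \<le> length (y # c # u # P)"
        using D by simp_all
      moreover have "3 * (D - 3) + 5 + joint [] + 2 * (cost ?h (y # c # u # P) + cost ?h []) \<le> 2 * (n - 2 - 1)"
        using calculation(2) D by (simp del: cost.simps(1))
      ultimately have "free_full l ?h (y # c # u # P) [] (n - 2 - 1)"
        unfolding free_full_def using X(2)[of Green] ne
        by (intro conjI exI[of _ "D - 3"]) (simp_all del: cost.simps(1))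
      then show "win l (n - 2 - 1) ?h"
        by (rule full_end_win)
    next
      fix x
      assume x: "x \<noteq> Green" "\<not> hit h' x u" "\<not> hit h' x (hd P)"
      let ?h = "draw h' u (hd P) x"
      have "x = other b"
        using eq_other x(1,3) P(3) P'(3) by blast
      then have hdF: "full ?h (hd P)"
        using full_other[OF P(3), of ?h "hd P"] P'(3) un by (simp add: hit_draw)
      have "gpath ?h [y, c, u]" "cost ?h [y, c, u] = 0" "nbrs_in ?h y {c}" "hit ?h x u"
        using a(3,5,6,8) un by (auto simp: gpath_Cons green_or_forced_iff green_sym hit_draw intro: nbrs_in_draw)
      moreover have "length P + length [y, c, u] + (D - 3) = l" "5 \<le> D - 3"
        using D by simp_all
      moreover have "3 * (D - 3) + 5 + 2 * (cost ?h P + cost ?h [y, c, u]) \<le> 2 * (n - 2 - 1)"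
        using calculation(2) X(3)[of x] D by (simp del: cost.simps(1))
      moreover have "set P \<inter> set [y, c, u] = {}"
        using dis un by auto
      ultimately have "detached_half_full l ?h P [y, c, u] (n - 2 - 1)"
        unfolding detached_half_full_def using X(1,2)[of x] hdF x(1) ne
        by (intro conjI exI[of _ "D - 3"] exI[of _ x]) (simp_all add: nbrs_in_def del: cost.simps(1))
      then show "win l (n - 2 - 1) ?h"
        by (rule detached_half_full_win)
    next
      show "0 < n - 2"
        using D by linarith
    qed (use un(1) a(7) neq in \<open>auto simp: nbrs_in_def\<close>)
  qed (use D P in auto)
qed

subsection \<open>The tight phases\<close>

text \<open>The colour of \<open>c\<close> agrees with that of the half end of \<open>P\<close> exactly for odd \<open>r\<close>; this makes the
  last edge forced.\<close>

lemma tight_win: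
  assumes "2 \<le> k" "l = 4 * k + 3" "gpath h P" "length P = 2" "b \<noteq> Green" "hit h b (hd P)" "full h (last P)"
    "full h g" "bank h K" "length K + 2 * r + 2 = 4 * k" "set P \<inter> set K = {}" "g \<notin> set P" "g \<notin> set K"
    "c \<notin> set P" "c \<notin> set K" "c \<noteq> g" "hit h (if odd r then b else other b) c"
    "\<not> drawn h c (hd P)" "\<not> drawn h c g" "3 * r + 4 + joint K + (cost h P + cost h K) \<le> n"
  shows "win l n h"
  using assms(3-)
proof (induction r arbitrary: h K c n)
  case 0
  note a = "0.prems"
  have ne: "P \<noteq> []" "K \<noteq> []"
    using a(2,8) assms(1) by auto
  then have mem: "hd P \<in> set P" "last P \<in> set P" "hd K \<in> set K" "last K \<in> set K"
    by auto
  obtain s where s: "s \<notin> {c, g} \<union> set P \<union> set K" "\<And>y. \<not> drawn h s y" "\<And>y. \<not> drawn h y s"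
    by (rule ex_fresh[of "{c, g} \<union> set P \<union> set K" h]) auto
  note m = merge[OF a(1) ne(1) a(5,7,9)]
  have "s \<noteq> hd K" "c \<noteq> hd P"
    using s(1) mem a(12) by auto
  then have "gpath h ((P @ rev K) @ [s, g, c])"
    using m(1,2) s a(6,9-14,17) ne(2) by (subst gpath_append) (auto simp: gpath_Cons green_or_forced_iff last_rev drawn_sym[of h g c])
  moreover have "green_or_forced h c (hd P)"
    using forced_if_other[of h b "hd P" c] a(3,4,15,16) \<open>c \<noteq> hd P\<close> by (auto simp: green_or_forced_sym drawn_sym)
  moreover have "cost h [s, g, c] \<le> 2"
    by simp
  then have "cost h ((P @ rev K) @ [s, g, c]) + 1 \<le> n"
    using m(3) a(18) ne(2) cost_append_le[of h "P @ rev K" "[s, g, c]"] by (simp del: cost.simps)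
  ultimately show ?case
    using assms(2) a(2,8) ne by (intro close_cycle[of h "(P @ rev K) @ [s, g, c]"]) auto
next
  case (Suc r)
  note a = Suc.prems
  have ne: "P \<noteq> []"
    using a(2) by auto
  then have mem: "hd P \<in> set P" "last P \<in> set P"
    by auto
  have neq: "g \<noteq> hd P" "g \<noteq> last P" "c \<noteq> hd P" "c \<noteq> last P"
    using mem a(10,12) by auto
  let ?S = "{c, g} \<union> set P \<union> set K"
  let ?b = "if odd (Suc r) then b else other b"
  have X: "gpath h' P" "hit h' b (hd P)" "full h' (last P)" "full h' g" "bank h' K"
    "cost h' P \<le> cost h P" "cost h' K \<le> cost h K" if "grows h h' c ?S" for h'
  proof -
    show "gpath h' P"
      by (rule grows_gpath[OF that a(1)]) auto
    show "hit h' b (hd P)" "full h' (last P)" "full h' g"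
      using grows_hit[OF that] a(4,5,6) by auto
    show "bank h' K"
      by (rule bank_grows[OF a(7) that]) (use a(13) in auto)
    show "cost h' P \<le> cost h P" "cost h' K \<le> cost h K"
      by (rule grows_cost[OF that])+
  qed
  show ?case
  proof (rule probe[of n ?S c h ?b])
    fix h' z e m
    assume p: "z \<notin> ?S" "e \<notin> ?S" "z \<noteq> e" "grows h h' c ?S" "full h' c" "green_or_forced h' c z" "nbrs_in h' z {c}"
      "nbrs_in h' e {c}" "hit h' (other ?b) e" "m + 2 = n + cost h' [c, z]"
    note X = X[OF p(4)]
    have K': "bank h' (K @ [c, z])" "cost h' (K @ [c, z]) \<le> cost h' K + joint K + cost h' [c, z]"
      using bank_snoc[OF X(5) p(5) a(13) _ _ p(6,7)] p(1) by auto
    have "3 * r + 4 + joint (K @ [c, z]) + (cost h' P + cost h' (K @ [c, z])) \<le> m"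
      using K'(2) X(6,7) p(10) a(18) by (auto split: if_splits)
    moreover have "hit h' (if odd r then b else other b) e"
      using p(9) by (auto split: if_splits)
    moreover have "\<not> drawn h' e (hd P)" "\<not> drawn h' e g"
      using p(8) neq a(14) by (auto simp: nbrs_in_def)
    ultimately show "win l m h'"
      using X K'(1) a(2,3,8-14) p(1-3) by (intro Suc.IH[of h' "K @ [c, z]" e m]) auto
  next
    fix h' u y
    assume p: "u \<notin> ?S" "y \<notin> ?S" "u \<noteq> y" "grows h h' c ?S" "green h' c y" "green h' c u"
      "nbrs_in h' u {c}" "nbrs_in h' y {c}"
    note X = X[OF p(4)]
    have yl: "green_or_forced h' y (last P)" "green_or_forced h' (last P) y"
      using p(2,8) X(3) neq mem by (auto simp: green_or_forced_iff nbrs_in_def drawn_sym)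
    have gP: "green_or_forced h' u g" "c \<noteq> u" "c \<noteq> y" "g \<noteq> u" "g \<noteq> y"
      using p(1,2,7) X(4) a(14) by (auto simp: green_or_forced_iff nbrs_in_def)
    show "win l (n - 2) h'"
    proof (cases "K = []")
      \<comment> \<open>With no bank, joining \<open>g\<close> to the path would miss the bound of
        \<open>half_full\<close> by one unit. Kept detached, \<open>D = 4k - 3\<close> is exactly
        \<open>2r - 1\<close> for the current \<open>r = 2k - 1\<close>; with a bank, joining
        \<open>g\<close> is affordable.\<close>
      case True
      have "gpath h' (u # c # y # rev P)"
        using X(1) p(1-6) a(12) yl ne by (auto simp: gpath_Cons green_or_forced_iff green_sym hd_rev)
      moreover have "cost h' (u # c # y # rev P) \<le> cost h P + 1"
        using X(6) p(5,6) ne by (auto simp: cost_Cons green_sym hd_rev)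
      moreover have "nbrs_in h' u (set (u # c # y # rev P))"
        by (rule nbrs_in_mono[OF p(7)]) auto
      moreover have "set [g] \<inter> set (u # c # y # rev P) = {}"
        using a(10,14) gP by auto
      moreover have "5 \<le> 4 * k - 3" "length [g] + length (u # c # y # rev P) + (4 * k - 3) = l"
        using assms(1,2) a(2) by auto
      moreover have "3 * (4 * k - 3) + 5 + 2 * (cost h' [g] + cost h' (u # c # y # rev P)) \<le> 2 * (n - 2)"
        using calculation(2) a(8,18) True assms(1) by (simp del: cost.simps(1))
      ultimately have "detached_half_full l h' [g] (u # c # y # rev P) (n - 2)"
        unfolding detached_half_full_def using X(2,4) a(3) ne
        by (intro conjI exI[of _ "4 * k - 3"] exI[of _ b]) (simp_all add: gpath_Cons last_rev del: cost.simps(1))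
      then show ?thesis
        by (rule detached_half_full_win)
    next
      case False
      have "gpath h' (P @ [y, c, u, g])"
        using X(1) p(1-6) a(10,12,14) yl gP ne by (auto simp: gpath_append gpath_Cons green_or_forced_iff green_sym)
      moreover have "cost h' [y, c, u, g] \<le> 1"
        using p(5,6) by (auto simp: green_sym)
      then have "cost h' (P @ [y, c, u, g]) \<le> cost h P + 2"
        using X(6) cost_append_le[of h' P "[y, c, u, g]"] by (simp del: cost.simps(1))
      moreover have "set (P @ [y, c, u, g]) \<inter> set K = {}"
        using a(9,11,13) p(1,2) by auto
      moreover have "length (P @ [y, c, u, g]) + length K + (2 * r + 1) = l"
        using assms(2) a(2,8) by simp
      moreover have "3 * (2 * r + 1) + 4 + joint K + 2 * (cost h' (P @ [y, c, u, g]) + cost h' K) \<le> 2 * (n - 2)"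
        using calculation(2) X(7) a(18) False by (simp del: cost.simps(1))
      ultimately have "half_full l h' (P @ [y, c, u, g]) K (n - 2)"
        unfolding half_full_def using X(2,4,5) a(3) ne
        by (intro conjI exI[of _ "2 * r + 1"] exI[of _ b]) (simp_all del: cost.simps(1))
      then show ?thesis
        by (rule full_end_win)
    qed
  qed (use a(3,15,18) in auto)
qed

text \<open>One spare round is left and \<open>q\<close>, \<open>c\<close> share a colour. Refusing
  the edge \<open>c q\<close> makes both full. After a green \<open>c q\<close>, a refusal at
  \<open>c\<close> yields a vertex whose edge to \<open>q\<close> is forced, and a later refusal at
  \<open>q\<close> makes \<open>q\<close> full. In every case five vertices containing
  \<open>g\<close>, \<open>c\<close> and \<open>q\<close> complete \<open>K\<close> to the
  cycle.\<close>

lemma alternating_win_last: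
  assumes "2 \<le> k" "l = 4 * k + 3" "b \<noteq> Green" "hit h b q" "hit h b c" "nbrs_in h q {g}" "full h g" "bank h K"
    "length K + 2 = 4 * k" "g \<noteq> q" "c \<noteq> q" "c \<noteq> g" "g \<notin> set K" "q \<notin> set K" "c \<notin> set K"
    "\<not> drawn h c (hd K)" "\<not> drawn h c g" "7 + cost h K \<le> n"
  shows "win l n h"
proof -
  have ne: "K \<noteq> []"
    using assms(1,9) by auto
  then have mem: "hd K \<in> set K" "last K \<in> set K"
    by auto
  then have neq: "hd K \<noteq> g" "hd K \<noteq> q" "hd K \<noteq> c" "last K \<noteq> g" "last K \<noteq> q" "last K \<noteq> c"
    using assms(13-15) by metis+
  have KF: "full h (hd K)" "gpath h K" "nbrs_in h (last K) (set K)"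
    using assms(8) ne by (auto simp: bank_def)
  have close: "win l m h'" if "gpath h' K" "gpath h' X" "length X = 5" "set X \<inter> set K = {}" "full h' (hd K)"
    "\<not> drawn h' (last X) (hd K)" "nbrs_in h' (last K) (set K)" "full h' (hd X)" "cost h' K \<le> cost h K"
    "cost h K + cost h' X + 2 \<le> m" for h' X m
  proof -
    have X: "X \<noteq> []"
      using that(3) by auto
    have "hd X \<notin> set K" "last X \<notin> set K"
      using that(4) hd_in_set[OF X] last_in_set[OF X] by (metis disjoint_iff)+
    then have "hd X \<noteq> last K" "last X \<noteq> hd K" "\<not> drawn h' (last K) (hd X)"
      using mem that(7) by (auto simp: nbrs_in_def)
    then have "gpath h' (K @ X)" "green_or_forced h' (last (K @ X)) (hd (K @ X))"
      using that X ne by (auto simp: gpath_append green_or_forced_iff)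
    then show ?thesis
      using cost_append_le[of h' K X] that(3,9,10) assms(2,9) by (intro close_cycle[of h' "K @ X"]) auto
  qed
  have cq: "\<not> drawn h c q"
    using assms(6,12) by (auto simp: nbrs_in_def drawn_sym)
  show ?thesis
  proof (rule step_pred[of n c q])
    fix x
    assume x: "x \<noteq> Green" "\<not> hit h x c" "\<not> hit h x q"
    let ?h = "draw h c q x"
    obtain s where s: "s \<notin> {c, g, q} \<union> set K" "\<And>y. \<not> drawn ?h s y" "\<And>y. \<not> drawn ?h y s"
      by (rule ex_fresh[of "{c, g, q} \<union> set K" ?h]) auto
    obtain t where t: "t \<notin> {c, g, q, s} \<union> set K" "\<And>y. \<not> drawn ?h t y" "\<And>y. \<not> drawn ?h y t"
      by (rule ex_fresh[of "{c, g, q, s} \<union> set K" ?h]) auto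
    have "x = other b"
      using eq_other x assms(3,4) by blast
    then have F: "full ?h c" "full ?h q"
      using full_other[OF assms(3), of ?h] assms(4,5,11) by (auto simp: hit_draw)
    have F': "full ?h g" "full ?h (hd K)"
      using assms(7,11) KF(1) by (auto simp: hit_draw)
    show "win l (n - 1) ?h"
    proof (rule close[of ?h "[q, s, g, t, c]"])
      show "gpath ?h K"
        by (rule gpath_draw[OF KF(2)]) (use assms(11,15) in auto)
      show "gpath ?h [q, s, g, t, c]"
        using s t assms(10-12) F F' by (auto simp: gpath_Cons green_or_forced_iff)
      show "\<not> drawn ?h (last [q, s, g, t, c]) (hd K)"
        using assms(16) neq by auto
      show "nbrs_in ?h (last K) (set K)"
        by (rule nbrs_in_draw[OF KF(3)]) (use neq in auto)
      have "cost ?h [q, s, g, t, c] \<le> 4"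
        using cost_less_length[of "[q, s, g, t, c]" ?h] by (simp del: cost.simps)
      then show "cost h K + cost ?h [q, s, g, t, c] + 2 \<le> n - 1"
        using assms(18) by (simp del: cost.simps)
    qed (use F F' s(1) t(1) assms(13-15) cost_ext_le[of h c q x K] in auto)
  next
    let ?h = "draw h c q Green"
    let ?S = "{c, g, q} \<union> set K"
    have H: "gpath ?h K" "nbrs_in ?h (last K) (set K)" "full ?h g" "full ?h (hd K)" "hit ?h b c" "hit ?h b q"
      "cost ?h K \<le> cost h K"
      using KF neq assms(4,5,7,11,15) cost_ext_le[of h c q Green K]
      by (auto simp: hit_draw intro!: gpath_draw nbrs_in_draw)
    show "win l (n - 1) ?h"
    proof (rule sprout[of "n - 1" ?S c ?h])
      fix h' y x
      assume a: "y \<notin> ?S" "grows ?h h' c ?S" "nbrs_in h' y {c}" "x \<noteq> Green" "\<not> hit ?h x c" "hit h' x c" "hit h' x y"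
      have "x = other b"
        using eq_other a(4,5) assms(3) H(5) by blast
      then have F: "full h' c"
        using full_other[OF assms(3), of h' c] grows_hit[OF a(2) H(5)] a(6) by simp
      have F': "full h' g" "full h' (hd K)" "hit h' b q" "green h' c q"
        using grows_hit[OF a(2)] H grows_green[OF a(2), of c q] by auto
      obtain s where s: "s \<notin> insert y ?S" "\<And>v. \<not> drawn h' s v" "\<And>v. \<not> drawn h' v s"
        by (rule ex_fresh[of "insert y ?S" h']) auto
      have ny: "\<not> drawn h' y v" "\<not> drawn h' v y" if "v \<noteq> c" for v
        using a(3) that by (auto simp: nbrs_in_def drawn_sym)
      have qy: "green_or_forced h' q y"
        using forced_if_other[OF F'(3), of y] a(1,7) \<open>x = other b\<close> assms(3,11) ny[of q] by auto
      show "win l (n - 1 - 1) h'"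
      proof (rule close[of h' "[g, s, c, q, y]"])
        show "gpath h' K"
          by (rule grows_gpath[OF a(2) H(1)]) auto
        show "gpath h' [g, s, c, q, y]"
          using s a(1) assms(10-12) F F' qy by (auto simp: gpath_Cons green_or_forced_iff[of _ g] green_or_forced_iff[of _ s] green_or_forced_iff[of _ c])
        show "\<not> drawn h' (last [g, s, c, q, y]) (hd K)"
          using ny[of "hd K"] neq by auto
        show "nbrs_in h' (last K) (set K)"
          by (rule grows_nbrs_in[OF a(2) H(2)]) (use neq mem in auto)
        have "cost h' [g, s, c, q, y] \<le> 3"
          using F'(4) by simp
        then show "cost h K + cost h' [g, s, c, q, y] + 2 \<le> n - 1 - 1"
          using assms(18) by (simp del: cost.simps)
        show "cost h' K \<le> cost h K"
          using grows_cost[OF a(2), of K] H(7) by simp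
      qed (use F F' s(1) a(1) assms(13-15) in auto)
    next
      fix h' y
      assume a: "y \<notin> ?S" "grows ?h h' c ?S" "nbrs_in h' y {c}" "green h' c y"
      let ?S' = "{c, g, q, y} \<union> set K"
      have ny: "\<not> drawn h' y v" "\<not> drawn h' v y" if "v \<noteq> c" for v
        using a(3) that by (auto simp: nbrs_in_def drawn_sym)
      have H': "gpath h' K" "nbrs_in h' (last K) (set K)" "full h' g" "full h' (hd K)" "hit h' b q" "green h' c q"
        "cost h' K \<le> cost h K"
        using grows_gpath[OF a(2) H(1)] grows_nbrs_in[OF a(2) H(2)] grows_hit[OF a(2)] H mem neq
          grows_green[OF a(2), of c q] grows_cost[OF a(2), of K] by auto
      have Y: "gpath h'' K" "nbrs_in h'' (last K) (set K)" "full h'' g" "full h'' (hd K)" "green h'' c q" "green h'' c y"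
        "green_or_forced h'' g y" "cost h'' K \<le> cost h K" if U: "grows h' h'' q ?S'" for h''
      proof -
        show "gpath h'' K"
          by (rule grows_gpath[OF U H'(1)]) auto
        show "nbrs_in h'' (last K) (set K)"
          by (rule grows_nbrs_in[OF U H'(2)]) (use mem neq in auto)
        show "full h'' g" "full h'' (hd K)" "green h'' c q" "green h'' c y"
          using grows_hit[OF U] grows_green[OF U] H' a(4) by auto
        show "cost h'' K \<le> cost h K"
          using grows_cost[OF U, of K] H'(7) by simp
        have "\<not> drawn h'' g y"
          using grows_drawn[OF U, of g y] ny[of g] assms(12) by auto
        then show "green_or_forced h'' g y"
          using \<open>full h'' g\<close> a(1) by (auto simp: green_or_forced_iff)
      qed
      show "win l (n - 1 - 1) h'"
      proof (rule sprout[of "n - 1 - 1" ?S' q h'])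
        fix h'' x
        assume e: "x \<notin> ?S'" "grows h' h'' q ?S'" "nbrs_in h'' x {q}" "green h'' q x"
        note Y = Y[OF e(2)]
        show "win l (n - 1 - 1 - 1) h''"
        proof (rule close[of h'' "[g, y, c, q, x]"])
          show "gpath h'' [g, y, c, q, x]"
            using e(1,4) a(1) assms(10-12) Y
            by (auto simp: gpath_Cons green_or_forced_iff[of _ y] green_or_forced_iff[of _ q] green_or_forced_iff[of _ c] green_sym[of _ y])
          show "\<not> drawn h'' (last [g, y, c, q, x]) (hd K)"
            using e(3) neq by (auto simp: nbrs_in_def)
          have "cost h'' [g, y, c, q, x] \<le> 1"
            using Y e(4) by (simp add: green_sym[of _ y])
          then show "cost h K + cost h'' [g, y, c, q, x] + 2 \<le> n - 1 - 1 - 1"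
            using assms(18) by (simp del: cost.simps)
        qed (use Y e(1) a(1) assms(13-15) in auto)
      next
        fix h'' x x'
        assume e: "x \<notin> ?S'" "grows h' h'' q ?S'" "nbrs_in h'' x {q}" "x' \<noteq> Green" "\<not> hit h' x' q" "hit h'' x' q"
          "hit h'' x' x"
        note Y = Y[OF e(2)]
        have "x' = other b"
          using eq_other e(4,5) assms(3) H'(5) by blast
        then have F: "full h'' q"
          using full_other[OF assms(3), of h'' q] grows_hit[OF e(2) H'(5)] e(6) by simp
        obtain s where s: "s \<notin> ?S'" "\<And>v. \<not> drawn h'' s v" "\<And>v. \<not> drawn h'' v s"
          by (rule ex_fresh[of ?S' h'']) auto
        show "win l (n - 1 - 1 - 1) h''"
        proof (rule close[of h'' "[g, y, c, q, s]"])
          show "gpath h'' [g, y, c, q, s]"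
            using s a(1) assms(10-12) Y F
            by (auto simp: gpath_Cons green_or_forced_iff[of _ y] green_or_forced_iff[of _ q] green_or_forced_iff[of _ c] green_sym[of _ y])
          have "cost h'' [g, y, c, q, s] \<le> 2"
            using Y by (simp add: green_sym[of _ y])
          then show "cost h K + cost h'' [g, y, c, q, s] + 2 \<le> n - 1 - 1 - 1"
            using assms(18) by (simp del: cost.simps)
        qed (use Y s a(1) assms(13-15) in auto)
      next
        show "0 < n - 1 - 1"
          using assms(18) by linarith
      qed auto
    next
      show "0 < n - 1"
        using assms(18) by linarith
    qed auto
  next
    show "0 < n"
      using assms(18) by linarith
  qed (use assms(11) cq in auto)
qed

text \<open>The red and blue edges form an alternating path \<open>q, g, \<dots>, c\<close>, whose interior vertices other than
  \<open>g\<close> are the full vertices of \<open>K\<close>.\<close>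

lemma alternating_win:
  assumes "2 \<le> k" "l = 4 * k + 3" "b \<noteq> Green" "hit h b q" "nbrs_in h q {g}" "full h g" "bank h K"
    "length K + 2 * r = 4 * k" "1 \<le> r" "g \<noteq> q" "c \<noteq> q" "c \<noteq> g" "g \<notin> set K" "q \<notin> set K" "c \<notin> set K"
    "hit h (if odd r then b else other b) c" "4 \<le> length K \<Longrightarrow> \<not> drawn h c (hd K)"
    "K \<noteq> [] \<Longrightarrow> \<not> drawn h c g" "3 * r + 3 + joint K + cost h K \<le> n"
  shows "win l n h"
  using assms(4-)
proof (induction r arbitrary: h K c n)
  case (Suc r)
  note a = Suc.prems
  let ?b = "if odd (Suc r) then b else other b"
  show ?case
  proof (cases "r = 0")
    case True
    then have "K \<noteq> []" "4 \<le> length K"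
      using a(5) assms(1) by auto
    then show ?thesis
      using a assms(1-3) True by (intro alternating_win_last[of k l b h q c g K]) auto
  next
    case False
    let ?S = "{c, g, q} \<union> set K"
    have X: "nbrs_in h' q {g}" "hit h' b q" "full h' g" "bank h' K" "cost h' K \<le> cost h K" if "grows h h' c ?S" for h'
    proof -
      show "nbrs_in h' q {g}"
        by (rule grows_nbrs_in[OF that a(2)]) (use a(8) in auto)
      show "hit h' b q" "full h' g"
        using grows_hit[OF that] a(1,3) by auto
      show "bank h' K"
        by (rule bank_grows[OF a(4) that]) (use a(12) in auto)
      show "cost h' K \<le> cost h K"
        by (rule grows_cost[OF that])
    qed
    show ?thesis
    proof (rule probe[of n ?S c h ?b])
      fix h' z e m
      assume p: "z \<notin> ?S" "e \<notin> ?S" "z \<noteq> e" "grows h h' c ?S" "full h' c" "green_or_forced h' c z" "nbrs_in h' z {c}"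
        "nbrs_in h' e {c}" "hit h' (other ?b) e" "m + 2 = n + cost h' [c, z]"
      note X = X[OF p(4)]
      have K': "bank h' (K @ [c, z])" "cost h' (K @ [c, z]) \<le> cost h' K + joint K + cost h' [c, z]"
        using bank_snoc[OF X(4) p(5) a(12) _ _ p(6,7)] p(1) by auto
      show "win l m h'"
      proof (rule Suc.IH[OF X(2,1,3) K'(1) _ _ a(7)])
        show "3 * r + 3 + joint (K @ [c, z]) + cost h' (K @ [c, z]) \<le> m"
          using K'(2) X(5) p(10) a(16) by (auto split: if_splits)
        show "hit h' (if odd r then b else other b) e"
          using p(9) by (auto split: if_splits)
        \<comment> \<open>The new end \<open>e\<close> is adjacent to \<open>c\<close> only, and
          \<open>c\<close> is the head of the bank just when the bank was empty; hence the guard on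
          the length.\<close>
        show "\<not> drawn h' e (hd (K @ [c, z]))" if "4 \<le> length (K @ [c, z])"
        proof -
          have "K \<noteq> []"
            using that by auto
          then have "hd (K @ [c, z]) \<in> set K"
            by simp
          then show ?thesis
            using p(8) a(12) by (metis nbrs_in_def singletonD)
        qed
        show "\<not> drawn h' e g"
          using p(8) a(9) by (auto simp: nbrs_in_def)
        show "length (K @ [c, z]) + 2 * r = 4 * k"
          using a(5) by simp
        show "g \<notin> set (K @ [c, z])" "q \<notin> set (K @ [c, z])" "e \<notin> set (K @ [c, z])"
          using a(8-11) p(1-3) by auto
      qed (use p(2) False in auto)
    next
      fix h' u y
      assume p: "u \<notin> ?S" "y \<notin> ?S" "u \<noteq> y" "grows h h' c ?S" "green h' c y" "green h' c u"
        "nbrs_in h' u {c}" "nbrs_in h' y {c}"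
      note X = X[OF p(4)]
      have un: "u \<noteq> q" "u \<noteq> g" "u \<noteq> c" "u \<notin> set K" "y \<noteq> q" "y \<noteq> g" "y \<noteq> c" "y \<notin> set K"
        using p(1,2) by auto
      have ql: "last K \<noteq> q" "last K \<noteq> u" if "K \<noteq> []"
        using last_in_set[OF that] a(11) un(4) by metis+
      have Y: "full (draw h' q u x) g" "bank (draw h' q u x) K" "cost (draw h' q u x) K \<le> cost h K"
        "green_or_forced (draw h' q u x) y g" for x
        using X un a(7,9,11) p(8) ql cost_ext_le[of h' q u x K]
        by (auto simp: hit_draw bank_def green_or_forced_iff nbrs_in_def[of _ y] intro!: gpath_draw nbrs_in_draw)
      show "win l (n - 2) h'"
      proof (rule step_pred[of "n - 2" q u])
        let ?h = "draw h' q u Green"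
        have "gpath ?h [q, u, c, y, g]" "cost ?h [q, u, c, y, g] \<le> 1"
          using un p(3,5,6) a(7-9) Y(4)[of Green]
          by (auto simp: gpath_Cons green_or_forced_iff[of _ q] green_or_forced_iff[of _ u] green_or_forced_iff[of _ c] green_sym[of _ u c])
        moreover have "set [q, u, c, y, g] \<inter> set K = {}"
          using un a(10-12) by auto
        moreover have "length [q, u, c, y, g] + length K + 2 * r = l" "1 \<le> 2 * r"
          using a(5) assms(2) False by auto
        moreover have "3 * (2 * r) + 4 + joint K + 2 * (cost ?h [q, u, c, y, g] + cost ?h K) \<le> 2 * (n - 2 - 1)"
          using calculation(2) Y(3)[of Green] a(16) by (auto simp del: cost.simps split: if_splits)
        moreover have "hit ?h b q"
          using X(2) un by (simp add: hit_draw)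
        ultimately have "half_full l ?h [q, u, c, y, g] K (n - 2 - 1)"
          unfolding half_full_def using Y(1,2)[of Green] assms(3)
          by (intro conjI exI[of _ "2 * r"] exI[of _ b]) (simp_all del: cost.simps)
        then show "win l (n - 2 - 1) ?h"
          by (rule full_end_win)
      next
        fix x
        assume x: "x \<noteq> Green" "\<not> hit h' x q" "\<not> hit h' x u"
        let ?h = "draw h' q u x"
        have "x = other b"
          using eq_other x(1,2) assms(3) X(2) by blast
        then have qF: "full ?h q"
          using full_other[OF assms(3), of ?h q] X(2) un by (simp add: hit_draw)
        \<comment> \<open>The refusing vertex \<open>q\<close> is full and extends the bank by
          \<open>q\<close> and a fresh vertex, while \<open>u\<close> takes over as half end of the
          path to \<open>g\<close>.\<close>
        obtain s where s: "s \<notin> {c, g, q, u, y} \<union> set K" "\<And>v. \<not> drawn ?h s v" "\<And>v. \<not> drawn ?h v s"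
          by (rule ex_fresh[of "{c, g, q, u, y} \<union> set K" ?h]) auto
        have "green_or_forced ?h q s" "nbrs_in ?h s {q}" "s \<noteq> q" "s \<notin> set K"
          using s qF by (auto simp: green_or_forced_iff nbrs_in_def)
        then have K': "bank ?h (K @ [q, s])" "cost ?h (K @ [q, s]) \<le> cost ?h K + joint K + cost ?h [q, s]"
          using bank_snoc[OF Y(2)[of x] qF a(11), of s] by auto
        have "gpath ?h [u, c, y, g]" "cost ?h [u, c, y, g] \<le> 1"
          using un p(3,5,6) a(7-9) Y(4)[of x]
          by (auto simp: gpath_Cons green_or_forced_iff[of _ u] green_or_forced_iff[of _ c] green_sym[of _ u c])
        moreover have "set [u, c, y, g] \<inter> set (K @ [q, s]) = {}"
          using un a(7-12) s(1) by auto
        moreover have "length [u, c, y, g] + length (K @ [q, s]) + (2 * r - 1) = l" "1 \<le> 2 * r - 1"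
          using a(5) assms(2) False by auto
        moreover have "cost ?h [q, s] \<le> 1"
          by simp
        then have "3 * (2 * r - 1) + 4 + joint (K @ [q, s]) + 2 * (cost ?h [u, c, y, g] + cost ?h (K @ [q, s]))
            \<le> 2 * (n - 2 - 1)"
          using calculation(2) Y(3)[of x] a(16) K'(2) False by (auto simp del: cost.simps split: if_splits)
        moreover have "hit ?h x u"
          using un by (simp add: hit_draw)
        ultimately have "half_full l ?h [u, c, y, g] (K @ [q, s]) (n - 2 - 1)"
          unfolding half_full_def using Y(1)[of x] K'(1) x(1)
          by (intro conjI exI[of _ "2 * r - 1"] exI[of _ x]) (simp_all del: cost.simps)
        then show "win l (n - 2 - 1) ?h"
          by (rule full_end_win)
      next
        show "0 < n - 2"
          using a(16) by (simp split: if_splits)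
      qed (use un p(7) a(8) in \<open>auto simp: nbrs_in_def drawn_sym\<close>)
    qed (use a(13,16) assms(3) in auto)
  qed
qed simp

subsection \<open>Paths without a full end\<close>

lemma star_close_Nil:
  assumes "gpath h P" "length P + 1 = l" "2 \<le> length P" "miss h (hd P) \<le> a" "miss h (last P) \<le> b"
    "1 \<le> a" "1 \<le> b" "2 * b + a + 1 + cost h P \<le> n"
  shows "win l n h"
  using assms by (intro star_close[of h P l "[]"]) (auto simp: star_cost_def)

text \<open>The bounds imply \<open>D \<le> 2r + 1\<close>, with equality only if
  \<open>r = 2k\<close> and \<open>P\<close> has two vertices. Short of equality \<open>g\<close>
  can be used at once, as a full end of the path or as the head of a bank; equality leads to the
  detached or the tight position.\<close>

lemma opposite_halves_win:
  assumes k: "4 \<le> k" "l = 4 * k + 3"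
    and P: "gpath h P" "2 \<le> length P" "b \<noteq> Green" "hit h (other b) (hd P)" "hit h b (last P)"
    and g: "full h g" "g \<notin> set P"
    and D: "2 \<le> D" "length P + D = l" "D + 2 * k \<le> 3 * r + 1" "r \<le> 2 * k" "D + 1 + r + cost h P \<le> n"
  shows "win l n h"
proof -
  have ne: "P \<noteq> []"
    using P(2) by auto
  then have mem: "hd P \<in> set P" "last P \<in> set P" "hd P \<noteq> last P"
    using hd_neq_last[OF P(1,2)] by auto
  have neq: "g \<noteq> hd P" "g \<noteq> last P"
    using mem g(2) by auto
  let ?S = "insert g (set P)"
  show ?thesis
  proof (rule sprout[of n ?S "hd P" h])
    fix h' u
    assume a: "u \<notin> ?S" "grows h h' (hd P) ?S" "nbrs_in h' u {hd P}" "green h' (hd P) u"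
    have X: "gpath h' P" "hit h' b (last P)" "full h' g" "cost h' P \<le> cost h P"
      using grows_gpath[OF a(2) P(1)] grows_hit[OF a(2)] P(5) g(1) grows_cost[OF a(2), of P] by auto
    have uP: "gpath h' (u # P)" "cost h' (u # P) \<le> cost h P"
      using X(1,4) a(1,4) ne by (auto simp: gpath_Cons green_or_forced_iff cost_Cons green_sym)
    consider "D = 2" | "3 \<le> D" "D \<le> 2 * r" | "D = 2 * r + 1"
      using D k by linarith
    then show "win l (n - 1) h'"
    proof cases
      case 1
      then have "3 \<le> r"
        using D(3) k by linarith
      then show ?thesis
        using 1 D uP X ne miss_le_2[of h' u] miss_le_1[OF X(2) P(3)] P(2)
        by (intro star_close_Nil[of h' "u # P" l 2 1]) auto
    next
      case 2
      have "green_or_forced h' u g"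
        using X(3) a(1,3) neq by (auto simp: green_or_forced_iff nbrs_in_def)
      then have "gpath h' (g # u # P)"
        using uP(1) a(1) g(2) by (auto simp: gpath_Cons[of _ g] green_or_forced_sym)
      then have "gpath h' (rev (g # u # P))"
        by (simp only: gpath_rev)
      moreover have "cost h' (rev (g # u # P)) \<le> cost h P + 1"
        using uP(2) unfolding cost_rev by simp
      moreover have "length (rev (g # u # P)) + length [] + (D - 2) = l"
        using D(2) 2 by simp
      moreover have "3 * (D - 2) + 4 + joint [] + 2 * (cost h' (rev (g # u # P)) + cost h' []) \<le> 2 * (n - 1)"
        using calculation(2) D(5) 2 by (simp del: cost.simps(1) cost_rev rev.simps)
      moreover have "hd (rev (g # u # P)) = last P" "last (rev (g # u # P)) = g"
        using ne by (auto simp: hd_rev)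
      ultimately have "half_full l h' (rev (g # u # P)) [] (n - 1)"
        unfolding half_full_def using X(2,3) P(3) 2
        by (intro conjI exI[of _ "D - 2"] exI[of _ b]) (simp_all del: cost.simps(1) cost_rev rev.simps)
      then show ?thesis
        by (rule full_end_win)
    next
      case 3
      then have r: "r = 2 * k" "length P = 2"
        using D k by auto
      have "nbrs_in h' u (set (u # P))"
        by (rule nbrs_in_mono[OF a(3)]) (use mem in auto)
      moreover have "3 * (4 * k - 1) + 5 + 2 * (cost h' [g] + cost h' (u # P)) \<le> 2 * (n - 1)"
        using uP(2) D(5) 3 r k(1) by simp
      ultimately have "detached_half_full l h' [g] (u # P) (n - 1)"
        unfolding detached_half_full_def using uP(1) X(2,3) P(2,3) a(1) g(2) ne k r
        by (intro conjI exI[of _ "4 * k - 1"] exI[of _ b]) (auto simp: gpath_Cons[of _ g])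
      then show ?thesis
        by (rule detached_half_full_win)
    qed
  next
    fix h' u x
    assume a: "u \<notin> ?S" "grows h h' (hd P) ?S" "nbrs_in h' u {hd P}" "x \<noteq> Green" "\<not> hit h x (hd P)"
      "hit h' x (hd P)" "hit h' x u"
    have X: "gpath h' (rev P)" "hit h' b (last P)" "full h' g" "cost h' (rev P) \<le> cost h P"
      using grows_gpath[OF a(2) P(1)] grows_hit[OF a(2)] P(5) g(1) grows_cost[OF a(2), of P] by auto
    have x: "x = b"
      using eq_other[OF a(4) _ a(5) P(4)] P(3) by simp
    have half_full: "full h' (hd P)"
      using full_other[of b h' "hd P"] P(3) grows_hit[OF a(2) P(4)] a(6) x by simp
    have und: "\<not> drawn h' u (last P)" "\<not> drawn h' u g" "\<not> drawn h' (last P) u"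
      using a(3) mem neq by (auto simp: nbrs_in_def drawn_sym)
    consider "D = 2" | "3 \<le> D" "D \<le> 2 * r" | "D = 2 * r + 1"
      using D k by linarith
    then show "win l (n - 1) h'"
    proof cases
      case 1
      then have "3 \<le> r"
        using D(3) k by linarith
      then have "half_full l h' (rev P) [] (n - 1)"
        unfolding half_full_def using X half_full P(2,3) ne D 1
        by (intro conjI exI[of _ 2] exI[of _ b]) (auto simp: hd_rev last_rev)
      then show ?thesis
        by (rule full_end_win)
    next
      case 2
      obtain s where s: "s \<notin> {g, u} \<union> set P" "\<And>v. \<not> drawn h' s v" "\<And>v. \<not> drawn h' v s"
        by (rule ex_fresh[of "{g, u} \<union> set P" h']) auto
      then have "green_or_forced h' g s" "nbrs_in h' s {g}" "g \<noteq> s"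
        using X(3) by (auto simp: green_or_forced_iff nbrs_in_def)
      then have bk: "bank h' [g, s]"
        using bank_snoc(1)[of h' "[]" g s] X(3) by simp
      have "cost h' [g, s] \<le> 1"
        by simp
      then have "3 * (D - 2) + 3 + joint [g, s] + 2 * (cost h' (rev P) + cost h' [g, s]) \<le> 2 * (n - 1)"
        using X(4) D(5) 2 by (simp del: cost.simps cost_rev)
      moreover have "set (rev P) \<inter> set [g, s] = {}" "u \<notin> set (rev P) \<union> set [g, s]"
        using s(1) g(2) a(1) by auto
      ultimately have "half_full_plus l h' (rev P) [g, s] u (n - 1)"
        unfolding half_full_plus_def using X(1,2) half_full bk P(2,3) a(7) x 2 D(2) ne und
        by (intro conjI exI[of _ "D - 2"] exI[of _ b]) (simp_all add: hd_rev last_rev del: cost.simps cost_rev)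
      then show ?thesis
        by (rule full_end_win)
    next
      case 3
      then have r: "r = 2 * k" "length P = 2"
        using D k by auto
      \<comment> \<open>In \<open>tight_win\<close> the colour of \<open>u\<close> must agree with
        that of the half end, which happens for odd \<open>r\<close>.\<close>
      have odd: "odd (2 * k - 1)"
        using k(1) by simp
      have "length [] + 2 * (2 * k - 1) + 2 = 4 * k"
        using k(1) by simp
      moreover have "3 * (2 * k - 1) + 4 + joint [] + (cost h' (rev P) + cost h' []) \<le> n - 1"
        using X(4) D(5) 3 r k(1) by simp
      moreover have "2 \<le> k"
        using k(1) by simp
      ultimately show ?thesis
        using k(2) X r half_full P(3) ne g(2) a(1,7) x odd und
        by (intro tight_win[of k l h' "rev P" b g "[]" "2 * k - 1" u "n - 1"]) (simp_all add: hd_rev last_rev)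
    qed
  qed (use D mem in auto)
qed

text \<open>The bound on \<open>3r\<close> records that each red or blue edge spent so far has paid for three vertices.\<close>

definition free_free :: "nat \<Rightarrow> nat \<Rightarrow> history \<Rightarrow> nat list \<Rightarrow> nat \<Rightarrow> bool" where
  "free_free k l h P n \<longleftrightarrow> gpath h P \<and> 2 \<le> length P \<and>
     (\<exists>D r. 1 \<le> D \<and> length P + D = l \<and> D + 2 * k + 5 \<le> 3 * r \<and> r \<le> 2 * k + 2 \<and> D + 1 + r + cost h P \<le> n)"

text \<open>The constants 5, 3, 4 make the circuit \<open>free_free\<close>,
  \<open>half_half\<close>, \<open>free_half\<close>, \<open>free_free\<close> lossless: it spends
  one coloured edge and adds three vertices.\<close>

definition free_half :: "nat \<Rightarrow> nat \<Rightarrow> history \<Rightarrow> nat list \<Rightarrow> nat \<Rightarrow> bool" where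
  "free_half k l h P n \<longleftrightarrow> gpath h P \<and> 3 \<le> length P \<and> nbrs_in h (hd P) (set P - {last P}) \<and>
     (\<exists>b. b \<noteq> Green \<and> hit h b (last P)) \<and>
     (\<exists>D r. 1 \<le> D \<and> length P + D = l \<and> D + 2 * k + 4 \<le> 3 * r \<and> r \<le> 2 * k + 1 \<and> D + 1 + r + cost h P \<le> n)"

definition half_half :: "nat \<Rightarrow> nat \<Rightarrow> history \<Rightarrow> nat list \<Rightarrow> nat \<Rightarrow> bool" where
  "half_half k l h P n \<longleftrightarrow> gpath h P \<and> 2 \<le> length P \<and> (\<exists>b. b \<noteq> Green \<and> hit h b (hd P) \<and> hit h b (last P)) \<and>
     (\<exists>D r. 1 \<le> D \<and> length P + D = l \<and> D + 2 * k + 3 \<le> 3 * r \<and> r \<le> 2 * k + 1 \<and> D + 1 + r + cost h P \<le> n)"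

text \<open>A green edge absorbs \<open>c\<close> and makes the ends half with equal colours; a
  refusal makes \<open>c\<close> full and the ends half with opposite colours.\<close>

lemma free_half_plus_win:
  assumes k: "4 \<le> k" "l = 4 * k + 3"
    and IH: "\<And>m h P. m < n \<Longrightarrow> half_half k l h P m \<Longrightarrow> win l m h"
    and P: "gpath h P" "2 \<le> length P" "b \<noteq> Green" "hit h b (last P)" "hit h b c" "\<not> drawn h c (hd P)" "c \<notin> set P"
    and D: "2 \<le> D" "length P + D = l" "D + 2 * k + 2 \<le> 3 * r" "r \<le> 2 * k + 1" "D + 1 + r + cost h P \<le> n"
  shows "win l n h"
proof -
  have ne: "P \<noteq> []"
    using P(2) by auto
  then have mem: "hd P \<in> set P" "last P \<in> set P" "hd P \<noteq> last P"
    using hd_neq_last[OF P(1,2)] by auto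
  have neq: "c \<noteq> hd P" "c \<noteq> last P"
    using mem P(7) by auto
  have X: "gpath (draw h c (hd P) x) P" "hit (draw h c (hd P) x) b (last P)" "hit (draw h c (hd P) x) b c"
    "cost (draw h c (hd P) x) P \<le> cost h P" for x
    using P neq cost_ext_le[of h c "hd P" x P] by (auto simp: hit_draw intro!: gpath_draw)
  show ?thesis
  proof (rule step_pred[of n c "hd P"])
    let ?h = "draw h c (hd P) Green"
    have "gpath ?h (c # P)" "cost ?h (c # P) \<le> cost h P"
      using X[of Green] P(7) ne by (auto simp: gpath_Cons green_or_forced_iff cost_Cons)
    then have "half_half k l ?h (c # P) (n - 1)"
      unfolding half_half_def using X[of Green] P(2,3) ne D
      by (intro conjI exI[of _ "D - 1"] exI[of _ r] exI[of _ b]) auto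
    then show "win l (n - 1) ?h"
      using D by (intro IH) auto
  next
    fix x
    assume x: "x \<noteq> Green" "\<not> hit h x c" "\<not> hit h x (hd P)"
    let ?h = "draw h c (hd P) x"
    have "x = other b"
      using eq_other x(1,2) P(3,5) by blast
    then have "full ?h c" "hit ?h (other b) (hd P)"
      using full_other[of b ?h c] P(3) X(3)[of x] neq by (auto simp: hit_draw)
    then show "win l (n - 1) ?h"
      using X[of x] P(2,3,7) D k by (intro opposite_halves_win[of k l ?h P b c D "r - 1"]) auto
  qed (use D neq P in auto)
qed

lemma free_free_win:
  assumes k: "4 \<le> k" "l = 4 * k + 3"
    and IH: "\<And>m h P. m < n \<Longrightarrow> half_half k l h P m \<Longrightarrow> win l m h"
    and IH0: "\<And>m h P. m < n \<Longrightarrow> free_free k l h P m \<Longrightarrow> win l m h"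
    and st: "free_free k l h P n"
  shows "win l n h"
proof -
  from st obtain D r where P: "gpath h P" "2 \<le> length P"
    and D: "1 \<le> D" "length P + D = l" "D + 2 * k + 5 \<le> 3 * r" "r \<le> 2 * k + 2" "D + 1 + r + cost h P \<le> n"
    by (auto simp: free_free_def)
  have ne: "P \<noteq> []"
    using P(2) by auto
  then have mem: "hd P \<in> set P" "last P \<in> set P" "hd P \<noteq> last P"
    using hd_neq_last[OF P(1,2)] by auto
  show ?thesis
  proof (cases "D = 1")
    case True
    \<comment> \<open>This is where \<open>k \<ge> 4\<close> is sharp: closing between two free ends
      takes \<open>2 * 2 + 2 + 1 = 7\<close> rounds besides the cost, \<open>r + 2\<close> are
      available, and \<open>3r \<ge> 2k + 6 \<ge> 14\<close>.\<close>
    then have "5 \<le> r"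
      using D(3) k by linarith
    then show ?thesis
      using True D P miss_le_2[of h] by (intro star_close_Nil[of h P l 2 2]) auto
  next
    case False
    show ?thesis
    proof (rule sprout[of n "set P" "last P" h])
      fix h' u
      assume a: "u \<notin> set P" "grows h h' (last P) (set P)" "nbrs_in h' u {last P}" "green h' (last P) u"
      have "gpath h' P" "cost h' P \<le> cost h P"
        using grows_gpath[OF a(2) P(1)] grows_cost[OF a(2), of P] by auto
      then have "gpath h' (P @ [u])" "cost h' (P @ [u]) \<le> cost h P"
        using a(1,4) ne by (auto simp: gpath_append gpath_Cons green_or_forced_iff cost_append)
      then have "free_free k l h' (P @ [u]) (n - 1)"
        unfolding free_free_def using P(2) D False by (intro conjI exI[of _ "D - 1"] exI[of _ r]) auto
      then show "win l (n - 1) h'"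
        using D by (intro IH0) auto
    next
      fix h' u x
      assume a: "u \<notin> set P" "grows h h' (last P) (set P)" "nbrs_in h' u {last P}" "x \<noteq> Green" "\<not> hit h x (last P)"
        "hit h' x (last P)" "hit h' x u"
      have X: "gpath h' P" "cost h' P \<le> cost h P"
        using grows_gpath[OF a(2) P(1)] grows_cost[OF a(2), of P] by auto
      have "\<not> drawn h' u (hd P)"
        using a(3) mem by (auto simp: nbrs_in_def)
      moreover have "win l m h''" if "m < n - 1" "half_half k l h'' Q m" for m h'' Q
        using IH[of m h'' Q] that by simp
      ultimately show "win l (n - 1) h'"
        using k X P(2) a D False
        by (intro free_half_plus_win[of k l "n - 1" h' P x u D "r - 1"]) auto
    qed (use D mem in auto)
  qed
qed

lemma half_half_win:
  assumes k: "4 \<le> k" "l = 4 * k + 3"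
    and IH: "\<And>m h P. m < n \<Longrightarrow> free_half k l h P m \<Longrightarrow> win l m h"
    and st: "half_half k l h P n"
  shows "win l n h"
proof -
  from st obtain b D r where P: "gpath h P" "2 \<le> length P" "b \<noteq> Green" "hit h b (hd P)" "hit h b (last P)"
    and D: "1 \<le> D" "length P + D = l" "D + 2 * k + 3 \<le> 3 * r" "r \<le> 2 * k + 1" "D + 1 + r + cost h P \<le> n"
    by (auto simp: half_half_def)
  have ne: "P \<noteq> []"
    using P(2) by auto
  then have mem: "hd P \<in> set P" "last P \<in> set P" "hd P \<noteq> last P"
    using hd_neq_last[OF P(1,2)] by auto
  show ?thesis
  proof (cases "D = 1")
    case True
    then have "4 \<le> r"
      using D(3) k by linarith
    then show ?thesis
      using True D P miss_le_1[OF P(4,3)] miss_le_1[OF P(5,3)] by (intro star_close_Nil[of h P l 1 1]) auto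
  next
    case False
    show ?thesis
    proof (rule sprout[of n "set P" "last P" h])
      fix h' u
      assume a: "u \<notin> set P" "grows h h' (last P) (set P)" "nbrs_in h' u {last P}" "green h' (last P) u"
      have X: "gpath h' P" "cost h' P \<le> cost h P" "hit h' b (hd P)"
        using grows_gpath[OF a(2) P(1)] grows_cost[OF a(2), of P] grows_hit[OF a(2) P(4)] by auto
      then have "gpath h' (u # rev P)" "cost h' (u # rev P) \<le> cost h P"
        using a(1,4) ne by (auto simp: gpath_Cons green_or_forced_iff cost_Cons hd_rev green_sym)
      moreover have "nbrs_in h' u (set (u # rev P) - {last (u # rev P)})"
        by (rule nbrs_in_mono[OF a(3)]) (use mem ne in \<open>auto simp: last_rev\<close>)
      ultimately have "free_half k l h' (u # rev P) (n - 1)"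
        unfolding free_half_def using P(2,3) D False X(3) ne
        by (intro conjI exI[of _ "D - 1"] exI[of _ r] exI[of _ b]) (auto simp: last_rev)
      then show "win l (n - 1) h'"
        using D by (intro IH) auto
    next
      fix h' u x
      assume a: "u \<notin> set P" "grows h h' (last P) (set P)" "nbrs_in h' u {last P}" "x \<noteq> Green" "\<not> hit h x (last P)"
        "hit h' x (last P)" "hit h' x u"
      have X: "gpath h' P" "cost h' P \<le> cost h P" "hit h' b (hd P)" "hit h' b (last P)"
        using grows_gpath[OF a(2) P(1)] grows_cost[OF a(2), of P] grows_hit[OF a(2)] P(4,5) by auto
      have x: "x = other b"
        using eq_other a(4,5) P(3,5) by blast
      have lF: "full h' (last P)"
        using full_other[OF P(3) X(4)] a(6) x by simp
      show "win l (n - 1) h'"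
      proof (cases "8 \<le> D")
        case True
        then show ?thesis
          using X P(2,3) lF a(1,7) x D k by (intro opposite_win[of h' P b u D]) auto
      next
        \<comment> \<open>Attaching \<open>u\<close> without a bank needs
          \<open>D \<le> 2r - 3\<close>, which holds because \<open>D \<le> 7\<close> and
          \<open>r \<ge> 5\<close>. For larger \<open>D\<close> only \<open>D \<le> 2r - 2\<close>
          is known, and this is what \<open>opposite_win\<close> needs.\<close>
        case small: False
        have "5 \<le> r"
          using D(1,3) False k by linarith
        have "hd P \<noteq> u" "\<not> drawn h' (hd P) u"
          using a(1) mem nbrs_in_not_drawn[OF a(3), of "hd P"] by auto
        then have "green_or_forced h' (hd P) u"
          using forced_if_other[OF X(3), of u] a(7) x P(3) by simp
        then have "gpath h' (u # P)" "cost h' (u # P) \<le> cost h P + 1"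
          using X(1,2) a(1) ne by (auto simp: gpath_Cons green_or_forced_sym cost_Cons)
        then have "half_full l h' (u # P) [] (n - 1)"
          unfolding half_full_def using lF P(2) ne a(4,7) D False small \<open>5 \<le> r\<close>
          by (intro conjI exI[of _ "D - 1"] exI[of _ x]) auto
        then show ?thesis
          by (rule full_end_win)
      qed
    qed (use D mem in auto)
  qed
qed

lemma free_half_win:
  assumes k: "4 \<le> k" "l = 4 * k + 3"
    and IH: "\<And>m h P. m < n \<Longrightarrow> free_free k l h P m \<Longrightarrow> win l m h"
    and st: "free_half k l h P n"
  shows "win l n h"
proof -
  from st obtain b D r where P: "gpath h P" "3 \<le> length P" "nbrs_in h (hd P) (set P - {last P})" "b \<noteq> Green" "hit h b (last P)"
    and D: "1 \<le> D" "length P + D = l" "D + 2 * k + 4 \<le> 3 * r" "r \<le> 2 * k + 1" "D + 1 + r + cost h P \<le> n"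
    by (auto simp: free_half_def)
  have ne: "P \<noteq> []"
    using P(2) by auto
  then have mem: "hd P \<in> set P" "last P \<in> set P" "hd P \<noteq> last P"
    using hd_neq_last[OF P(1)] P(2) by auto
  have r: "5 \<le> r"
    using D(1,3) k by linarith
  show ?thesis
  proof (cases "D = 1")
    case True
    then show ?thesis
      using D P miss_le_2[of h "hd P"] miss_le_1[OF P(5,4)] r by (intro star_close_Nil[of h P l 2 1]) auto
  next
    case False
    show ?thesis
    proof (rule sprout[of n "set P" "last P" h])
      fix h' u
      assume a: "u \<notin> set P" "grows h h' (last P) (set P)" "nbrs_in h' u {last P}" "green h' (last P) u"
      have "gpath h' P" "cost h' P \<le> cost h P"
        using grows_gpath[OF a(2) P(1)] grows_cost[OF a(2), of P] by auto
      then have "gpath h' (P @ [u])" "cost h' (P @ [u]) \<le> cost h P"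
        using a(1,4) ne by (auto simp: gpath_append gpath_Cons green_or_forced_iff cost_append)
      then have "free_free k l h' (P @ [u]) (n - 1)"
        unfolding free_free_def using P(2) D False by (intro conjI exI[of _ "D - 1"] exI[of _ r]) auto
      then show "win l (n - 1) h'"
        using D by (intro IH) auto
    next
      fix h' u x
      assume a: "u \<notin> set P" "grows h h' (last P) (set P)" "nbrs_in h' u {last P}" "x \<noteq> Green" "\<not> hit h x (last P)"
        "hit h' x (last P)" "hit h' x u"
      have X: "gpath h' P" "cost h' P \<le> cost h P" "nbrs_in h' (hd P) (set P - {last P})" "hit h' b (last P)"
        using grows_gpath[OF a(2) P(1)] grows_cost[OF a(2), of P] grows_nbrs_in[OF a(2) P(3)] grows_hit[OF a(2) P(5)] mem by auto
      have x: "x = other b"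
        using eq_other a(4,5) P(4,5) by blast
      have lF: "full h' (last P)"
        using full_other[OF P(4) X(4)] a(6) x by simp
      have un: "u \<noteq> hd P" "u \<noteq> last P" "\<not> drawn h' u (hd P)"
        using a(1,3) mem by (auto simp: nbrs_in_def)
      show "win l (n - 1) h'"
      proof (cases "D + 5 \<le> 2 * r")
        case True
        have "free_full l h' P [] (n - 1)"
          unfolding free_full_def using X lF P(2) D True by (intro conjI exI[of _ D]) auto
        then show ?thesis
          by (rule full_end_win)
      next
        \<comment> \<open>Only \<open>D = 2r - 4\<close> and \<open>D = 2r - 3\<close> remain, by
          the bound on \<open>r\<close>. The edge from \<open>u\<close> to the free end repairs
          both: green attaches a half end, and a refusal makes \<open>u\<close> full, hence the head
          of a bank.\<close>
        case big: False
        have Y: "gpath (draw h' u (hd P) y) P" "full (draw h' u (hd P) y) (last P)"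
          "cost (draw h' u (hd P) y) P \<le> cost h P" "hit (draw h' u (hd P) y) x u" for y
          using X lF un a(1,7) cost_ext_le[of h' u "hd P" y P] by (auto simp: hit_draw intro!: gpath_draw)
        show ?thesis
        proof (rule step_pred[of "n - 1" u "hd P"])
          let ?h = "draw h' u (hd P) Green"
          have "gpath ?h (u # P)" "cost ?h (u # P) \<le> cost h P"
            using Y[of Green] a(1) ne by (auto simp: gpath_Cons green_or_forced_iff cost_Cons)
          then have "half_full l ?h (u # P) [] (n - 1 - 1)"
            unfolding half_full_def using Y[of Green] a(4) P(2) ne D big r k
            by (intro conjI exI[of _ "D - 1"] exI[of _ x]) auto
          then show "win l (n - 1 - 1) ?h"
            by (rule full_end_win)
        next
          fix y
          assume y: "y \<noteq> Green" "\<not> hit h' y u" "\<not> hit h' y (hd P)"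
          let ?h = "draw h' u (hd P) y"
          have "y = other x"
            using eq_other[OF y(1) a(4) y(2) a(7)] .
          then have uF: "full ?h u" and hy: "hit ?h y (hd P)"
            using full_other[OF a(4) Y(4)[of y]] un by (auto simp: hit_draw)
          obtain s where s: "s \<notin> insert u (set P)" "\<And>v. \<not> drawn ?h s v" "\<And>v. \<not> drawn ?h v s"
            by (rule ex_fresh[of "insert u (set P)" ?h]) auto
          then have "green_or_forced ?h u s" "nbrs_in ?h s {u}" "u \<noteq> s"
            using uF by (auto simp: green_or_forced_iff nbrs_in_def)
          then have bk: "bank ?h [u, s]"
            using bank_snoc(1)[of ?h "[]" u s] uF by simp
          have "cost ?h [u, s] \<le> 1"
            by simp
          then have "3 * (D - 2) + 4 + joint [u, s] + 2 * (cost ?h P + cost ?h [u, s]) \<le> 2 * (n - 1 - 1)"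
            using Y(3)[of y] D big r k(1) by (simp del: cost.simps)
          moreover have "1 \<le> D - 2" "length P + length [u, s] + (D - 2) = l"
            using D(2) big r by auto
          moreover have "set P \<inter> set [u, s] = {}"
            using a(1) s(1) by auto
          ultimately have "half_full l ?h P [u, s] (n - 1 - 1)"
            unfolding half_full_def using Y(1,2)[of y] bk hy y(1) P(2)
            by (intro conjI exI[of _ "D - 2"] exI[of _ y]) (simp_all del: cost.simps)
          then show "win l (n - 1 - 1) ?h"
            by (rule full_end_win)
        next
          show "0 < n - 1"
            using D by linarith
        qed (use un in auto)
      qed
    qed (use D mem in auto)
  qed
qed

lemma no_full_end_win:
  assumes k: "4 \<le> k" "l = 4 * k + 3"
  shows "free_free k l h P n \<Longrightarrow> win l n h" "half_half k l h P n \<Longrightarrow> win l n h" "free_half k l h P n \<Longrightarrow> win l n h"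
proof -
  have "(\<forall>P. free_free k l h P n \<longrightarrow> win l n h) \<and> (\<forall>P. half_half k l h P n \<longrightarrow> win l n h) \<and>
      (\<forall>P. free_half k l h P n \<longrightarrow> win l n h)" for h
  proof (induction n arbitrary: h rule: less_induct)
    case (less n)
    have 1: "win l m h" if "m < n" "free_free k l h P m" for m h P
      using less[OF that(1), of h] that(2) by blast
    have 2: "win l m h" if "m < n" "half_half k l h P m" for m h P
      using less[OF that(1), of h] that(2) by blast
    have 3: "win l m h" if "m < n" "free_half k l h P m" for m h P
      using less[OF that(1), of h] that(2) by blast
    have "win l n h" if "free_free k l h P n" for P
      using k 2 1 that by (rule free_free_win)
    moreover have "win l n h" if "half_half k l h P n" for P
      using k 3 that by (rule half_half_win)
    moreover have "win l n h" if "free_half k l h P n" for P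
      using k 1 that by (rule free_half_win)
    ultimately show ?case
      by blast
  qed
  then show "free_free k l h P n \<Longrightarrow> win l n h" "half_half k l h P n \<Longrightarrow> win l n h" "free_half k l h P n \<Longrightarrow> win l n h"
    by blast+
qed

section \<open>The opening moves\<close>

lemma win_from_start:
  assumes k: "4 \<le> k" "l = 4 * k + 3"
  shows "win l (6 * k + 5) []"
proof (rule step_pred[of _ 0 1])
  let ?h = "draw [] 0 1 Green"
  \<comment> \<open>Both bounds of the position hold with equality: \<open>4k + 1\<close> vertices
    are missing and all \<open>2k + 2\<close> spare rounds remain.\<close>
  have "free_free k l ?h [0, 1] (6 * k + 4)"
    unfolding free_free_def using k
    by (intro conjI exI[of _ "4 * k + 1"] exI[of _ "2 * k + 2"]) (auto simp: gpath_Cons green_or_forced_iff)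
  from no_full_end_win(1)[OF k this] show "win l (6 * k + 5 - 1) ?h"
    by (simp add: add.commute)
next
  fix x
  assume x: "x \<noteq> Green"
  let ?h = "draw [] 0 1 x"
  have "\<not> drawn [] u v" for u v
    by (simp add: drawn_def)
  then have H: "hit ?h x 0" "hit ?h x 1" "nbrs_in ?h 0 {1}"
    by (auto simp: hit_draw nbrs_in_def)
  show "win l (6 * k + 5 - 1) ?h"
  proof (rule sprout[of _ "{0, 1}" 1 ?h])
    fix h' u
    assume a: "u \<notin> {0, 1}" "grows ?h h' 1 {0, 1}" "nbrs_in h' u {1}" "green h' 1 u"
    have "hit h' x 0" "hit h' x 1"
      using grows_hit[OF a(2)] H by auto
    moreover have "gpath h' [u, 1]" "cost h' [u, 1] = 0"
      using a(1,4) by (auto simp: gpath_Cons green_or_forced_iff green_sym)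
    moreover have "\<not> drawn h' 0 u"
      using a(3) by (auto simp: nbrs_in_def drawn_sym)
    ultimately show "win l (6 * k + 5 - 1 - 1) h'"
      using a(1) k x no_full_end_win(2)[OF k]
      by (intro free_half_plus_win[of k l _ h' "[u, 1]" x 0 "4 * k + 1" "2 * k + 1"]) auto
  next
    fix h' u y
    assume a: "u \<notin> {0, 1}" "grows ?h h' 1 {0, 1}" "nbrs_in h' u {1}" "y \<noteq> Green" "\<not> hit ?h y 1" "hit h' y 1" "hit h' y u"
    have y: "y = other x"
      using eq_other[OF a(4) x a(5) H(2)] .
    have "hit h' x 0" "hit h' x 1" "nbrs_in h' 0 {1}"
      using grows_hit[OF a(2)] H grows_nbrs_in[OF a(2) H(3)] by auto
    moreover from this have "full h' 1"
      using full_other[OF x, of h' 1] a(6) y by simp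
    ultimately show "win l (6 * k + 5 - 1 - 1) h'"
      \<comment> \<open>The alternating path has two edges so far; \<open>r = 2k\<close> is even,
        matching the colour \<open>other x\<close> at its end \<open>u\<close>.\<close>
      using a(1,7) y k x by (intro alternating_win[of k l x h' 0 1 "[]" "2 * k" u]) auto
  qed auto
qed (auto simp: drawn_def)

theorem theorem4p19:
  fixes k :: nat
  assumes "k \<ge> 4"
  shows "online_ramsey (path_graph 3) (path_graph 3) (cycle_graph (4 * k + 3)) \<le> enat (6 * k + 5)"
proof -
  have "builder_wins_within (path_graph 3) (path_graph 3) (cycle_graph (4 * k + 3)) (6 * k + 5)"
    using assms by (intro builder_wins_within_if_win win_from_start) auto
  then show ?thesis
    unfolding online_ramsey_def by (intro Inf_lower) auto
qed

end
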